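(* Let $\Gamma$ be a commutative group and $S,T$ commutative ternary $\Gamma$-semirings. Let $\psi:(\mathrm{Spec}_\Gamma(S),\mathcal{O}_S)\to(\mathrm{Spec}_\Gamma(T),\mathcal{O}_T)$ be an isomorphism of affine $\Gamma$-schemes and assume both spectra are finite. Then the induced bijection on points is an isomorphism of specialization graphs, hence $$L_{\mathrm{Spec}_\Gamma(S)}=P^{-1}L_{\mathrm{Spec}_\Gamma(T)}P$$ for a permutation matrix $P$ corresponding to the vertex relabeling.
   Context: A commutative semiring is a tuple $(T,+,\cdot,0,1)$ with $(T,+,0)$ and $(T,\cdot,1)$ commutative monoids, multiplication distributing over addition, and $0\cdot x=x\cdot 0=0$. A commutative ternary $\Gamma$-semiring $(T,u)$ is a commutative semiring $T$ with a group homomorphism $u:\Gamma\to T^\times$, $\gamma\mapsto u_\gamma$, together with the operations $\{a\,b\,c\}_\gamma:=a b c u_\gamma$. A $\Gamma$-ideal of $T$ is a subset $I$ which is a submonoid of $(T,+,0)$ and satisfies $\{a\,b\,c\}_\gamma\in I$ for all $a\in I$, $b,c\in T$, $\gamma\in\Gamma$. A proper $\Gamma$-ideal $P$ is prime if $\{a\,b\,c\}_\gamma\in P$ implies $a\in P$ or $b\in P$ or $c\in P$, for all $a,b,c\in T$, $\gamma\in\Gamma$. $\mathrm{Spec}_\Gamma(T)$ is the set of prime $\Gamma$-ideals with the topology whose closed sets are $V(I)=\{P\mid I\subseteq P\}$ for $\Gamma$-ideals $I$; the principal opens $D_\Gamma(f)=\{P\mid f\notin P\}$ form a basis. For $f\in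 T$, $T_f$ is the localization of the semiring $T$ at $S_f=\{1,f,f^2,\dots\}$: fractions $\frac as$ with $\frac as=\frac bt$ iff $wat=wbs$ for some $w\in S_f$. The structure sheaf $\mathcal{O}_T$ is the unique sheaf of semirings extending $\mathcal{O}_T(D_\Gamma(f))=T_f$ (restrictions being the unique semiring homomorphisms $T_f\to T_g$ compatible with the canonical maps from $T$); sections carry the ternary operations $\{s_1\,s_2\,s_3\}_\gamma=s_1s_2s_3u_\gamma$. The affine $\Gamma$-scheme of $T$ is $(\mathrm{Spec}_\Gamma(T),\mathcal{O}_T)$. A morphism of $\Gamma$-schemes $f:X\to Y$ is a morphism of ringed spaces (sheaves of semirings) whose maps on sections over affine opens of $Y$ respect the ternary $\Gamma$-operations; an isomorphism is an invertible morphism. For finite $X=\mathrm{Spec}_\Gamma(T)$, the specialization order is $P\le Q$ iff $P\subseteq Q$ (equivalently $Q\in\overline{\{P\}}$). The specialization graph $G_X$ is the undirected graph with vertex set $X$ and an edge between distinct $P\ne Q$ iff $P\subseteq Q$ or $Q\subseteq P$. With $A_X$ its adjacency matrix and $D_X$ the diagonal degree matrix (for a chosen ordering of vertices), the canonical Laplacian is $L_X:=D_X-A_X$. *)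

theory Defs
  imports "HOL-Analysis.Abstract_Topology" "Jordan_Normal_Form.Matrix"
begin

locale comm_semiring = Ring.semiring T + comm_monoid T for T (structure)

text \<open>The library's \<open>ring_hom\<close> does not ask for preservation of zero, which is not
  automatic for semirings.\<close>

definition semiring_hom :: "('a, 'm) ring_scheme \<Rightarrow> ('b, 'n) ring_scheme \<Rightarrow> ('a \<Rightarrow> 'b) set"
  where "semiring_hom R S = {h \<in> ring_hom R S. h \<zero>\<^bsub>R\<^esub> = \<zero>\<^bsub>S\<^esub>}"

definition powers :: "('a, 'm) ring_scheme \<Rightarrow> 'a \<Rightarrow> 'a set"
  where "powers T f = {f [^]\<^bsub>T\<^esub> n |n :: nat. True}"

text \<open>The fraction \<open>a/s\<close> is the equivalence class of \<open>(a, s)\<close>.\<close>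

definition fraction :: "('a, 'm) ring_scheme \<Rightarrow> 'a \<Rightarrow> 'a \<Rightarrow> 'a \<Rightarrow> ('a \<times> 'a) set"
  where "fraction T f a s =
    {(b, t). b \<in> carrier T \<and> t \<in> powers T f \<and>
       (\<exists>w \<in> powers T f. w \<otimes>\<^bsub>T\<^esub> a \<otimes>\<^bsub>T\<^esub> t = w \<otimes>\<^bsub>T\<^esub> b \<otimes>\<^bsub>T\<^esub> s)}"

definition localization :: "('a, 'm) ring_scheme \<Rightarrow> 'a \<Rightarrow> ('a \<times> 'a) set ring"
  where "localization T f =
    \<lparr>carrier = {fraction T f a s |a s. a \<in> carrier T \<and> s \<in> powers T f},
     mult = (\<lambda>x y. \<Union>(a, s) \<in> x. \<Union>(b, t) \<in> y. fraction T f (a \<otimes>\<^bsub>T\<^esub> b) (s \<otimes>\<^bsub>T\<^esub> t)),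
     one = fraction T f \<one>\<^bsub>T\<^esub> \<one>\<^bsub>T\<^esub>,
     zero = fraction T f \<zero>\<^bsub>T\<^esub> \<one>\<^bsub>T\<^esub>,
     add = (\<lambda>x y. \<Union>(a, s) \<in> x. \<Union>(b, t) \<in> y.
              fraction T f (a \<otimes>\<^bsub>T\<^esub> t \<oplus>\<^bsub>T\<^esub> b \<otimes>\<^bsub>T\<^esub> s) (s \<otimes>\<^bsub>T\<^esub> t))\<rparr>"

abbreviation to_loc :: "('a, 'm) ring_scheme \<Rightarrow> 'a \<Rightarrow> 'a \<Rightarrow> ('a \<times> 'a) set"
  where "to_loc T f a \<equiv> fraction T f a \<one>\<^bsub>T\<^esub>"

text \<open>Functions are total in HOL, so uniqueness is only sensible among maps that are
  normalised to \<open>undefined\<close> off the carrier.\<close>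

definition loc_res :: "('a, 'm) ring_scheme \<Rightarrow> 'a \<Rightarrow> 'a \<Rightarrow> ('a \<times> 'a) set \<Rightarrow> ('a \<times> 'a) set"
  where "loc_res T f g =
    (THE h. h \<in> semiring_hom (localization T f) (localization T g) \<and>
            h \<in> extensional (carrier (localization T f)) \<and>
            (\<forall>a \<in> carrier T. h (to_loc T f a) = to_loc T g a))"

locale gamma_semiring = comm_semiring T + \<Gamma>: comm_group \<Gamma>
  for \<Gamma> :: "('g, 'k) monoid_scheme" and T :: "('a, 'm) ring_scheme" (structure)
    and u :: "'g \<Rightarrow> 'a" +
  assumes u_hom: "u \<in> hom \<Gamma> (units_of T)"

definition ternary :: "('a, 'm) ring_scheme \<Rightarrow> ('g \<Rightarrow> 'a) \<Rightarrow> 'g \<Rightarrow> 'a \<Rightarrow> 'a \<Rightarrow> 'a \<Rightarrow> 'a"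
  where "ternary T u \<gamma> a b c = a \<otimes>\<^bsub>T\<^esub> b \<otimes>\<^bsub>T\<^esub> c \<otimes>\<^bsub>T\<^esub> u \<gamma>"

definition gamma_ideal ::
    "('g, 'k) monoid_scheme \<Rightarrow> ('a, 'm) ring_scheme \<Rightarrow> ('g \<Rightarrow> 'a) \<Rightarrow> 'a set \<Rightarrow> bool"
  where "gamma_ideal \<Gamma> T u I \<longleftrightarrow>
    submonoid I (add_monoid T) \<and>
    (\<forall>a \<in> I. \<forall>b \<in> carrier T. \<forall>c \<in> carrier T. \<forall>\<gamma> \<in> carrier \<Gamma>. ternary T u \<gamma> a b c \<in> I)"

definition prime_gamma_ideal ::
    "('g, 'k) monoid_scheme \<Rightarrow> ('a, 'm) ring_scheme \<Rightarrow> ('g \<Rightarrow> 'a) \<Rightarrow> 'a set \<Rightarrow> bool"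
  where "prime_gamma_ideal \<Gamma> T u P \<longleftrightarrow>
    gamma_ideal \<Gamma> T u P \<and> P \<noteq> carrier T \<and>
    (\<forall>a \<in> carrier T. \<forall>b \<in> carrier T. \<forall>c \<in> carrier T. \<forall>\<gamma> \<in> carrier \<Gamma>.
       ternary T u \<gamma> a b c \<in> P \<longrightarrow> a \<in> P \<or> b \<in> P \<or> c \<in> P)"

definition Spec ::
    "('g, 'k) monoid_scheme \<Rightarrow> ('a, 'm) ring_scheme \<Rightarrow> ('g \<Rightarrow> 'a) \<Rightarrow> 'a set set"
  where "Spec \<Gamma> T u = {P. prime_gamma_ideal \<Gamma> T u P}"

definition vanishing ::
    "('g, 'k) monoid_scheme \<Rightarrow> ('a, 'm) ring_scheme \<Rightarrow> ('g \<Rightarrow> 'a) \<Rightarrow> 'a set \<Rightarrow> 'a set set"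
  where "vanishing \<Gamma> T u I = {P \<in> Spec \<Gamma> T u. I \<subseteq> P}"

definition basic_open ::
    "('g, 'k) monoid_scheme \<Rightarrow> ('a, 'm) ring_scheme \<Rightarrow> ('g \<Rightarrow> 'a) \<Rightarrow> 'a \<Rightarrow> 'a set set"
  where "basic_open \<Gamma> T u f = {P \<in> Spec \<Gamma> T u. f \<notin> P}"

definition spec_topology ::
    "('g, 'k) monoid_scheme \<Rightarrow> ('a, 'm) ring_scheme \<Rightarrow> ('g \<Rightarrow> 'a) \<Rightarrow> 'a set topology"
  where "spec_topology \<Gamma> T u =
    topology (\<lambda>U. \<exists>I. gamma_ideal \<Gamma> T u I \<and> U = Spec \<Gamma> T u - vanishing \<Gamma> T u I)"

definition basic_opens_in ::
    "('g, 'k) monoid_scheme \<Rightarrow> ('a, 'm) ring_scheme \<Rightarrow> ('g \<Rightarrow> 'a) \<Rightarrow> 'a set set \<Rightarrow> 'a set"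
  where "basic_opens_in \<Gamma> T u U = {f \<in> carrier T. basic_open \<Gamma> T u f \<subseteq> U}"

text \<open>The sheaf extending \<open>basic_open f \<mapsto> localization T f\<close> from the basis of principal opens:
  its semiring of sections over an open \<open>U\<close> is the limit of the \<open>localization T f\<close> over all
  \<open>f\<close> with \<open>basic_open f \<subseteq> U\<close>, realised as the compatible families inside the product. See
  \<open>affine_semiringed_space\<close> and \<open>sections_over_basic_open\<close> below for the proof that this is a
  sheaf with the prescribed sections and restrictions on principal opens.\<close>

definition structure_sheaf ::
    "('g, 'k) monoid_scheme \<Rightarrow> ('a, 'm) ring_scheme \<Rightarrow> ('g \<Rightarrow> 'a) \<Rightarrow> 'a set set
      \<Rightarrow> ('a \<Rightarrow> ('a \<times> 'a) set) ring"
  where "structure_sheaf \<Gamma> T u U =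
    \<lparr>carrier = {\<sigma> \<in> \<Pi>\<^sub>E f \<in> basic_opens_in \<Gamma> T u U. carrier (localization T f).
       \<forall>f \<in> basic_opens_in \<Gamma> T u U. \<forall>g \<in> carrier T.
         basic_open \<Gamma> T u g \<subseteq> basic_open \<Gamma> T u f \<longrightarrow> loc_res T f g (\<sigma> f) = \<sigma> g},
     mult = (\<lambda>\<sigma> \<tau>. \<lambda>f \<in> basic_opens_in \<Gamma> T u U. \<sigma> f \<otimes>\<^bsub>localization T f\<^esub> \<tau> f),
     one = (\<lambda>f \<in> basic_opens_in \<Gamma> T u U. \<one>\<^bsub>localization T f\<^esub>),
     zero = (\<lambda>f \<in> basic_opens_in \<Gamma> T u U. \<zero>\<^bsub>localization T f\<^esub>),
     add = (\<lambda>\<sigma> \<tau>. \<lambda>f \<in> basic_opens_in \<Gamma> T u U. \<sigma> f \<oplus>\<^bsub>localization T f\<^esub> \<tau> f)\<rparr>"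

definition to_section ::
    "('g, 'k) monoid_scheme \<Rightarrow> ('a, 'm) ring_scheme \<Rightarrow> ('g \<Rightarrow> 'a) \<Rightarrow> 'a set set \<Rightarrow> 'a
      \<Rightarrow> 'a \<Rightarrow> ('a \<times> 'a) set"
  where "to_section \<Gamma> T u U a = (\<lambda>f \<in> basic_opens_in \<Gamma> T u U. to_loc T f a)"

text \<open>The field \<open>res X U W\<close> is the restriction map from \<open>U\<close> to \<open>W \<subseteq> U\<close>.\<close>

record ('x, 'b, 'g) gamma_space =
  topol :: "'x topology"
  sections :: "'x set \<Rightarrow> 'b ring"
  res :: "'x set \<Rightarrow> 'x set \<Rightarrow> 'b \<Rightarrow> 'b"
  tern :: "'x set \<Rightarrow> 'g \<Rightarrow> 'b \<Rightarrow> 'b \<Rightarrow> 'b \<Rightarrow> 'b"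

definition semiringed_space :: "('x, 'b, 'g) gamma_space \<Rightarrow> bool"
  where "semiringed_space X \<longleftrightarrow>
    (\<forall>U. openin (topol X) U \<longrightarrow> comm_semiring (sections X U)) \<and>
    (\<forall>U W. openin (topol X) U \<longrightarrow> openin (topol X) W \<longrightarrow> W \<subseteq> U \<longrightarrow>
       res X U W \<in> semiring_hom (sections X U) (sections X W)) \<and>
    (\<forall>U. openin (topol X) U \<longrightarrow> (\<forall>s \<in> carrier (sections X U). res X U U s = s)) \<and>
    (\<forall>U W Z. openin (topol X) U \<longrightarrow> openin (topol X) W \<longrightarrow> openin (topol X) Z \<longrightarrow>
       Z \<subseteq> W \<longrightarrow> W \<subseteq> U \<longrightarrow>
       (\<forall>s \<in> carrier (sections X U). res X W Z (res X U W s) = res X U Z s)) \<and>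
    (\<forall>\<U>. (\<forall>U \<in> \<U>. openin (topol X) U) \<longrightarrow>
       (\<forall>s \<in> carrier (sections X (\<Union>\<U>)). \<forall>t \<in> carrier (sections X (\<Union>\<U>)).
          (\<forall>U \<in> \<U>. res X (\<Union>\<U>) U s = res X (\<Union>\<U>) U t) \<longrightarrow> s = t)) \<and>
    (\<forall>\<U> \<sigma>. (\<forall>U \<in> \<U>. openin (topol X) U \<and> \<sigma> U \<in> carrier (sections X U)) \<longrightarrow>
       (\<forall>U \<in> \<U>. \<forall>W \<in> \<U>. res X U (U \<inter> W) (\<sigma> U) = res X W (U \<inter> W) (\<sigma> W)) \<longrightarrow>
       (\<exists>s \<in> carrier (sections X (\<Union>\<U>)). \<forall>U \<in> \<U>. res X (\<Union>\<U>) U s = \<sigma> U))"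

definition affine_gamma_scheme ::
    "('g, 'k) monoid_scheme \<Rightarrow> ('a, 'm) ring_scheme \<Rightarrow> ('g \<Rightarrow> 'a)
      \<Rightarrow> ('a set, 'a \<Rightarrow> ('a \<times> 'a) set, 'g) gamma_space"
  where "affine_gamma_scheme \<Gamma> T u =
    \<lparr>topol = spec_topology \<Gamma> T u,
     sections = structure_sheaf \<Gamma> T u,
     res = (\<lambda>U W \<sigma>. restrict \<sigma> (basic_opens_in \<Gamma> T u W)),
     tern = (\<lambda>U. ternary (structure_sheaf \<Gamma> T u U) (\<lambda>\<gamma>. to_section \<Gamma> T u U (u \<gamma>)))\<rparr>"

text \<open>A morphism from \<open>X\<close> to \<open>Y\<close> is given by a map on points together with, for every open
  \<open>W\<close> of \<open>Y\<close>, a map from the sections over \<open>W\<close> to those over the preimage of \<open>W\<close>.\<close>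

type_synonym ('x, 'b, 'y, 'c) space_map = "('x \<Rightarrow> 'y) \<times> ('y set \<Rightarrow> 'c \<Rightarrow> 'b)"

abbreviation on_points :: "('x, 'b, 'y, 'c) space_map \<Rightarrow> 'x \<Rightarrow> 'y"
  where "on_points \<phi> \<equiv> fst \<phi>"

abbreviation on_sections :: "('x, 'b, 'y, 'c) space_map \<Rightarrow> 'y set \<Rightarrow> 'c \<Rightarrow> 'b"
  where "on_sections \<phi> \<equiv> snd \<phi>"

definition preimage ::
    "('x, 'b, 'g) gamma_space \<Rightarrow> ('x, 'b, 'y, 'c) space_map \<Rightarrow> 'y set \<Rightarrow> 'x set"
  where "preimage X \<phi> W = {x \<in> topspace (topol X). on_points \<phi> x \<in> W}"

definition semiringed_space_morphism ::
    "('x, 'b, 'g) gamma_space \<Rightarrow> ('y, 'c, 'g) gamma_space \<Rightarrow> ('x, 'b, 'y, 'c) space_map \<Rightarrow> bool"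
  where "semiringed_space_morphism X Y \<phi> \<longleftrightarrow>
    continuous_map (topol X) (topol Y) (on_points \<phi>) \<and>
    (\<forall>W. openin (topol Y) W \<longrightarrow>
       on_sections \<phi> W \<in> semiring_hom (sections Y W) (sections X (preimage X \<phi> W))) \<and>
    (\<forall>W Z. openin (topol Y) W \<longrightarrow> openin (topol Y) Z \<longrightarrow> Z \<subseteq> W \<longrightarrow>
       (\<forall>s \<in> carrier (sections Y W).
          on_sections \<phi> Z (res Y W Z s) =
          res X (preimage X \<phi> W) (preimage X \<phi> Z) (on_sections \<phi> W s)))"

definition respects_ternary_on ::
    "'y set \<Rightarrow> ('g, 'k) monoid_scheme \<Rightarrow> ('x, 'b, 'g) gamma_space \<Rightarrow> ('y, 'c, 'g) gamma_space
      \<Rightarrow> ('x, 'b, 'y, 'c) space_map \<Rightarrow> bool"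
  where "respects_ternary_on W \<Gamma> X Y \<phi> \<longleftrightarrow>
    (\<forall>\<gamma> \<in> carrier \<Gamma>. \<forall>a \<in> carrier (sections Y W).
     \<forall>b \<in> carrier (sections Y W). \<forall>c \<in> carrier (sections Y W).
       on_sections \<phi> W (tern Y W \<gamma> a b c) =
       tern X (preimage X \<phi> W) \<gamma>
         (on_sections \<phi> W a) (on_sections \<phi> W b) (on_sections \<phi> W c))"

definition mutually_inverse ::
    "('x, 'b, 'g) gamma_space \<Rightarrow> ('y, 'c, 'g) gamma_space
      \<Rightarrow> ('x, 'b, 'y, 'c) space_map \<Rightarrow> ('y, 'c, 'x, 'b) space_map \<Rightarrow> bool"
  where "mutually_inverse X Y \<phi> \<chi> \<longleftrightarrow>
    (\<forall>x \<in> topspace (topol X). on_points \<chi> (on_points \<phi> x) = x) \<and>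
    (\<forall>y \<in> topspace (topol Y). on_points \<phi> (on_points \<chi> y) = y) \<and>
    (\<forall>U. openin (topol X) U \<longrightarrow> (\<forall>s \<in> carrier (sections X U).
       on_sections \<phi> (preimage Y \<chi> U) (on_sections \<chi> U s) = s)) \<and>
    (\<forall>W. openin (topol Y) W \<longrightarrow> (\<forall>s \<in> carrier (sections Y W).
       on_sections \<chi> (preimage X \<phi> W) (on_sections \<phi> W s) = s))"

definition open_subspace :: "('x, 'b, 'g) gamma_space \<Rightarrow> 'x set \<Rightarrow> ('x, 'b, 'g) gamma_space"
  where "open_subspace X U = X\<lparr>topol := subtopology (topol X) U\<rparr>"

text \<open>Morphisms of \<open>\<Gamma>\<close>-schemes are defined through affine opens, so an open is declared
  affine by means of isomorphisms compatible with the ternary operations over every open;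
  this avoids a circularity. The semiring of an affine open is isomorphic to the semiring of
  sections over it, hence it may be taken on the type of sections.\<close>

definition strong_isomorphism ::
    "('g, 'k) monoid_scheme \<Rightarrow> ('x, 'b, 'g) gamma_space \<Rightarrow> ('y, 'c, 'g) gamma_space
      \<Rightarrow> ('x, 'b, 'y, 'c) space_map \<Rightarrow> bool"
  where "strong_isomorphism \<Gamma> X Y \<phi> \<longleftrightarrow>
    semiringed_space_morphism X Y \<phi> \<and>
    (\<forall>W. openin (topol Y) W \<longrightarrow> respects_ternary_on W \<Gamma> X Y \<phi>) \<and>
    (\<exists>\<chi>. semiringed_space_morphism Y X \<chi> \<and>
         (\<forall>U. openin (topol X) U \<longrightarrow> respects_ternary_on U \<Gamma> Y X \<chi>) \<and>
         mutually_inverse X Y \<phi> \<chi>)"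

definition affine_open ::
    "('g, 'k) monoid_scheme \<Rightarrow> ('y, 'c, 'g) gamma_space \<Rightarrow> 'y set \<Rightarrow> bool"
  where "affine_open \<Gamma> Y W \<longleftrightarrow>
    openin (topol Y) W \<and>
    (\<exists>(R :: 'c ring) v \<phi>. gamma_semiring \<Gamma> R v \<and>
       strong_isomorphism \<Gamma> (open_subspace Y W) (affine_gamma_scheme \<Gamma> R v) \<phi>)"

definition gamma_scheme_morphism ::
    "('g, 'k) monoid_scheme \<Rightarrow> ('x, 'b, 'g) gamma_space \<Rightarrow> ('y, 'c, 'g) gamma_space
      \<Rightarrow> ('x, 'b, 'y, 'c) space_map \<Rightarrow> bool"
  where "gamma_scheme_morphism \<Gamma> X Y \<phi> \<longleftrightarrow>
    semiringed_space_morphism X Y \<phi> \<and>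
    (\<forall>W. affine_open \<Gamma> Y W \<longrightarrow> respects_ternary_on W \<Gamma> X Y \<phi>)"

definition gamma_scheme_isomorphism ::
    "('g, 'k) monoid_scheme \<Rightarrow> ('x, 'b, 'g) gamma_space \<Rightarrow> ('y, 'c, 'g) gamma_space
      \<Rightarrow> ('x, 'b, 'y, 'c) space_map \<Rightarrow> bool"
  where "gamma_scheme_isomorphism \<Gamma> X Y \<phi> \<longleftrightarrow>
    gamma_scheme_morphism \<Gamma> X Y \<phi> \<and>
    (\<exists>\<chi>. gamma_scheme_morphism \<Gamma> Y X \<chi> \<and> mutually_inverse X Y \<phi> \<chi>)"

text \<open>A finite simple graph is a pair of a vertex set and a set of two-element vertex sets.\<close>

type_synonym 'v graph = "'v set \<times> 'v set set"

definition specialization_graph ::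
    "('g, 'k) monoid_scheme \<Rightarrow> ('a, 'm) ring_scheme \<Rightarrow> ('g \<Rightarrow> 'a) \<Rightarrow> 'a set graph"
  where "specialization_graph \<Gamma> T u =
    (Spec \<Gamma> T u,
     {{P, Q} |P Q. P \<in> Spec \<Gamma> T u \<and> Q \<in> Spec \<Gamma> T u \<and> P \<noteq> Q \<and> (P \<subseteq> Q \<or> Q \<subseteq> P)})"

definition graph_isomorphism :: "'v graph \<Rightarrow> 'w graph \<Rightarrow> ('v \<Rightarrow> 'w) \<Rightarrow> bool"
  where "graph_isomorphism G H \<phi> \<longleftrightarrow>
    bij_betw \<phi> (fst G) (fst H) \<and>
    (\<forall>v \<in> fst G. \<forall>w \<in> fst G. {v, w} \<in> snd G \<longleftrightarrow> {\<phi> v, \<phi> w} \<in> snd H)"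

definition vertex_ordering :: "'v graph \<Rightarrow> 'v list \<Rightarrow> bool"
  where "vertex_ordering G vs \<longleftrightarrow> distinct vs \<and> set vs = fst G"

definition vertex_degree :: "'v graph \<Rightarrow> 'v \<Rightarrow> nat"
  where "vertex_degree G v = card {w \<in> fst G. {v, w} \<in> snd G}"

definition adjacency_matrix :: "'v graph \<Rightarrow> 'v list \<Rightarrow> real mat"
  where "adjacency_matrix G vs =
    mat (length vs) (length vs) (\<lambda>(i, j). if {vs ! i, vs ! j} \<in> snd G then 1 else 0)"

definition degree_matrix :: "'v graph \<Rightarrow> 'v list \<Rightarrow> real mat"
  where "degree_matrix G vs =
    mat (length vs) (length vs) (\<lambda>(i, j). if i = j then real (vertex_degree G (vs ! i)) else 0)"

definition laplacian :: "'v graph \<Rightarrow> 'v list \<Rightarrow> real mat"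
  where "laplacian G vs = degree_matrix G vs - adjacency_matrix G vs"

definition permutation_matrix :: "nat \<Rightarrow> (nat \<Rightarrow> nat) \<Rightarrow> real mat"
  where "permutation_matrix n p = mat n n (\<lambda>(i, j). if i = p j then 1 else 0)"

text \<open>The rest of this theory checks that the definitions above are meaningful: the operations on
  fractions do not depend on representatives, the description in \<open>loc_res\<close> has exactly one
  solution when \<open>basic_open g \<subseteq> basic_open f\<close>, the sets used in \<open>spec_topology\<close> form a topology
  with the principal opens as a basis, and \<open>structure_sheaf\<close> is a sheaf.\<close>

context comm_semiring
begin

lemma powers_closed: "f \<in> carrier T \<Longrightarrow> s \<in> powers T f \<Longrightarrow> s \<in> carrier T"
  by (auto simp: powers_def)

lemma one_in_powers: "\<one> \<in> powers T f"
  unfolding powers_def by (metis (mono_tags, lifting) mem_Collect_eq nat_pow_0)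

lemma self_in_powers: "f \<in> carrier T \<Longrightarrow> f \<in> powers T f"
  unfolding powers_def by (auto intro!: exI[of _ "1::nat"])

lemma mult_in_powers:
  "f \<in> carrier T \<Longrightarrow> s \<in> powers T f \<Longrightarrow> t \<in> powers T f \<Longrightarrow> s \<otimes> t \<in> powers T f"
  unfolding powers_def by (auto simp: nat_pow_mult)

lemma pow_in_powers: "f \<in> carrier T \<Longrightarrow> s \<in> powers T f \<Longrightarrow> s [^] (n::nat) \<in> powers T f"
  unfolding powers_def by (auto simp: nat_pow_pow)

lemmas powers_rules = powers_closed one_in_powers mult_in_powers

lemma self_in_fraction:
  assumes "f \<in> carrier T" "a \<in> carrier T" "s \<in> powers T f"
  shows "(a, s) \<in> fraction T f a s"
  using assms one_in_powers unfolding fraction_def by blast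

lemma fraction_trans:
  assumes f: "f \<in> carrier T" and "a \<in> carrier T" "b \<in> carrier T" "c \<in> carrier T"
    and "s \<in> powers T f" "t \<in> powers T f" "r \<in> powers T f"
    and "w \<in> powers T f" "w \<otimes> a \<otimes> t = w \<otimes> b \<otimes> s"
    and "w' \<in> powers T f" "w' \<otimes> b \<otimes> r = w' \<otimes> c \<otimes> t"
  shows "(w \<otimes> w' \<otimes> t) \<in> powers T f" "(w \<otimes> w' \<otimes> t) \<otimes> a \<otimes> r = (w \<otimes> w' \<otimes> t) \<otimes> c \<otimes> s"
proof -
  note cl = assms(2-4) powers_closed[OF f assms(5)] powers_closed[OF f assms(6)]
    powers_closed[OF f assms(7)] powers_closed[OF f assms(8)] powers_closed[OF f assms(10)]
  show "(w \<otimes> w' \<otimes> t) \<in> powers T f" using assms by (simp add: mult_in_powers)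
  have "(w \<otimes> w' \<otimes> t) \<otimes> a \<otimes> r = w' \<otimes> r \<otimes> (w \<otimes> a \<otimes> t)"
    using cl by (simp add: m_ac)
  also have "\<dots> = w \<otimes> s \<otimes> (w' \<otimes> b \<otimes> r)" unfolding assms(9) using cl by (simp add: m_ac)
  also have "\<dots> = (w \<otimes> w' \<otimes> t) \<otimes> c \<otimes> s" unfolding assms(11) using cl by (simp add: m_ac)
  finally show "(w \<otimes> w' \<otimes> t) \<otimes> a \<otimes> r = (w \<otimes> w' \<otimes> t) \<otimes> c \<otimes> s" .
qed

lemma fraction_eq_iff:
  assumes f: "f \<in> carrier T" and a: "a \<in> carrier T" and b: "b \<in> carrier T"
    and s: "s \<in> powers T f" and t: "t \<in> powers T f"
  shows "fraction T f a s = fraction T f b t \<longleftrightarrow> (\<exists>w \<in> powers T f. w \<otimes> a \<otimes> t = w \<otimes> b \<otimes> s)"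
proof
  assume "fraction T f a s = fraction T f b t"
  then have "(b, t) \<in> fraction T f a s" using self_in_fraction[OF f b t] by simp
  then show "\<exists>w \<in> powers T f. w \<otimes> a \<otimes> t = w \<otimes> b \<otimes> s" by (auto simp: fraction_def)
next
  assume "\<exists>w \<in> powers T f. w \<otimes> a \<otimes> t = w \<otimes> b \<otimes> s"
  then obtain w where w: "w \<in> powers T f" "w \<otimes> a \<otimes> t = w \<otimes> b \<otimes> s" by blast
  show "fraction T f a s = fraction T f b t"
  proof (intro equalityI subrelI)
    fix c r assume "(c, r) \<in> fraction T f a s"
    then obtain w' where "c \<in> carrier T" "r \<in> powers T f" "w' \<in> powers T f" "w' \<otimes> a \<otimes> r = w' \<otimes> c \<otimes> s"
      by (auto simp: fraction_def)
    then show "(c, r) \<in> fraction T f b t"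
      using fraction_trans[OF f b a _ t s _ w(1) w(2)[symmetric]] unfolding fraction_def by blast
  next
    fix c r assume "(c, r) \<in> fraction T f b t"
    then obtain w' where "c \<in> carrier T" "r \<in> powers T f" "w' \<in> powers T f" "w' \<otimes> b \<otimes> r = w' \<otimes> c \<otimes> t"
      by (auto simp: fraction_def)
    then show "(c, r) \<in> fraction T f a s"
      using fraction_trans[OF f a b _ s t _ w] unfolding fraction_def by blast
  qed
qed

lemma fraction_eqI:
  assumes "f \<in> carrier T" "a \<in> carrier T" "b \<in> carrier T" "s \<in> powers T f" "t \<in> powers T f"
    "a \<otimes> t = b \<otimes> s"
  shows "fraction T f a s = fraction T f b t"
proof -
  have "\<one> \<otimes> a \<otimes> t = \<one> \<otimes> b \<otimes> s" using assms by simp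
  then show ?thesis
    using assms one_in_powers[of f] unfolding fraction_eq_iff[OF assms(1-5)] by blast
qed

lemma in_fraction_eq:
  assumes "f \<in> carrier T" "a \<in> carrier T" "s \<in> powers T f" "(b, t) \<in> fraction T f a s"
  shows "b \<in> carrier T" "t \<in> powers T f" "fraction T f b t = fraction T f a s"
  using assms fraction_eq_iff[of f a b s t] by (auto simp: fraction_def)

lemma localization_carrierE:
  assumes "x \<in> carrier (localization T f)"
  obtains a s where "a \<in> carrier T" "s \<in> powers T f" "x = fraction T f a s"
  using assms by (auto simp: localization_def)

lemma fraction_closed:
  "a \<in> carrier T \<Longrightarrow> s \<in> powers T f \<Longrightarrow> fraction T f a s \<in> carrier (localization T f)"
  by (auto simp: localization_def)

lemma UN_pairs_const:
  assumes "(a, s) \<in> x" "(b, t) \<in> y"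
    and "\<And>a s b t. (a, s) \<in> x \<Longrightarrow> (b, t) \<in> y \<Longrightarrow> F a s b t = C"
  shows "(\<Union>(a, s) \<in> x. \<Union>(b, t) \<in> y. F a s b t) = C"
proof -
  have "(\<Union>(a, s) \<in> x. \<Union>(b, t) \<in> y. F a s b t) = (\<Union>p \<in> x. \<Union>q \<in> y. C)"
    using assms(3) by (intro SUP_cong) auto
  also have "\<dots> = C" using assms(1,2) by auto
  finally show ?thesis .
qed

lemma mult_fraction:
  assumes f: "f \<in> carrier T" and a: "a \<in> carrier T" and b: "b \<in> carrier T"
    and s: "s \<in> powers T f" and t: "t \<in> powers T f"
  shows "fraction T f a s \<otimes>\<^bsub>localization T f\<^esub> fraction T f b t = fraction T f (a \<otimes> b) (s \<otimes> t)"
proof -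
  have "fraction T f (a' \<otimes> b') (s' \<otimes> t') = fraction T f (a \<otimes> b) (s \<otimes> t)"
    if h: "(a', s') \<in> fraction T f a s" "(b', t') \<in> fraction T f b t" for a' s' b' t'
  proof -
    obtain w where w: "a' \<in> carrier T" "s' \<in> powers T f" "w \<in> powers T f" "w \<otimes> a \<otimes> s' = w \<otimes> a' \<otimes> s"
      using h(1) by (auto simp: fraction_def)
    obtain v where v: "b' \<in> carrier T" "t' \<in> powers T f" "v \<in> powers T f" "v \<otimes> b \<otimes> t' = v \<otimes> b' \<otimes> t"
      using h(2) by (auto simp: fraction_def)
    note cl = a b w(1) v(1) powers_closed[OF f s] powers_closed[OF f t] powers_closed[OF f w(2)]
      powers_closed[OF f w(3)] powers_closed[OF f v(2)] powers_closed[OF f v(3)]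
    have "(w \<otimes> v) \<otimes> (a' \<otimes> b') \<otimes> (s \<otimes> t) = (w \<otimes> a' \<otimes> s) \<otimes> (v \<otimes> b' \<otimes> t)"
      using cl by (simp add: m_ac)
    also have "\<dots> = (w \<otimes> v) \<otimes> (a \<otimes> b) \<otimes> (s' \<otimes> t')"
      unfolding w(4)[symmetric] v(4)[symmetric] using cl by (simp add: m_ac)
    finally show ?thesis
      using f a b s t w v mult_in_powers by (subst fraction_eq_iff) auto
  qed
  moreover have "(a, s) \<in> fraction T f a s" "(b, t) \<in> fraction T f b t"
    using self_in_fraction f a b s t by auto
  ultimately show ?thesis
    unfolding localization_def monoid.simps ring.simps
    by (intro UN_pairs_const[of a s _ b t _ "\<lambda>a s b t. fraction T f (a \<otimes> b) (s \<otimes> t)"])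
qed

lemma add_fraction:
  assumes f: "f \<in> carrier T" and a: "a \<in> carrier T" and b: "b \<in> carrier T"
    and s: "s \<in> powers T f" and t: "t \<in> powers T f"
  shows "fraction T f a s \<oplus>\<^bsub>localization T f\<^esub> fraction T f b t =
    fraction T f (a \<otimes> t \<oplus> b \<otimes> s) (s \<otimes> t)"
proof -
  have "fraction T f (a' \<otimes> t' \<oplus> b' \<otimes> s') (s' \<otimes> t') = fraction T f (a \<otimes> t \<oplus> b \<otimes> s) (s \<otimes> t)"
    if h: "(a', s') \<in> fraction T f a s" "(b', t') \<in> fraction T f b t" for a' s' b' t'
  proof -
    obtain w where w: "a' \<in> carrier T" "s' \<in> powers T f" "w \<in> powers T f" "w \<otimes> a \<otimes> s' = w \<otimes> a' \<otimes> s"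
      using h(1) by (auto simp: fraction_def)
    obtain v where v: "b' \<in> carrier T" "t' \<in> powers T f" "v \<in> powers T f" "v \<otimes> b \<otimes> t' = v \<otimes> b' \<otimes> t"
      using h(2) by (auto simp: fraction_def)
    note cl = a b w(1) v(1) powers_closed[OF f s] powers_closed[OF f t] powers_closed[OF f w(2)]
      powers_closed[OF f w(3)] powers_closed[OF f v(2)] powers_closed[OF f v(3)]
    have "(w \<otimes> v) \<otimes> (a' \<otimes> t' \<oplus> b' \<otimes> s') \<otimes> (s \<otimes> t) =
        (w \<otimes> a' \<otimes> s) \<otimes> (v \<otimes> t \<otimes> t') \<oplus> (v \<otimes> b' \<otimes> t) \<otimes> (w \<otimes> s \<otimes> s')"
      using cl by (simp add: m_ac r_distr l_distr)
    also have "\<dots> = (w \<otimes> v) \<otimes> (a \<otimes> t \<oplus> b \<otimes> s) \<otimes> (s' \<otimes> t')"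
      unfolding w(4)[symmetric] v(4)[symmetric] using cl by (simp add: m_ac r_distr l_distr)
    finally show ?thesis
      using f a b s t w v mult_in_powers powers_closed by (subst fraction_eq_iff) auto
  qed
  moreover have "(a, s) \<in> fraction T f a s" "(b, t) \<in> fraction T f b t"
    using self_in_fraction f a b s t by auto
  ultimately show ?thesis
    unfolding localization_def monoid.simps ring.simps
    by (intro UN_pairs_const[of a s _ b t _ "\<lambda>a s b t. fraction T f (a \<otimes> t \<oplus> b \<otimes> s) (s \<otimes> t)"])
qed

lemma localization_one: "\<one>\<^bsub>localization T f\<^esub> = to_loc T f \<one>"
  and localization_zero: "\<zero>\<^bsub>localization T f\<^esub> = to_loc T f \<zero>"
  by (simp_all add: localization_def)

lemma localization_comm_semiring:
  assumes f: "f \<in> carrier T"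
  shows "comm_semiring (localization T f)"
proof -
  let ?L = "localization T f"
  have pc: "s \<in> powers T f \<Longrightarrow> s \<in> carrier T" for s using powers_closed[OF f] .
  note s = f one_in_powers mult_in_powers[OF f] mult_fraction add_fraction fraction_closed pc
    localization_one localization_zero
  have am: "abelian_monoid ?L"
  proof (rule abelian_monoidI)
    fix x y z assume xyz: "x \<in> carrier ?L" "y \<in> carrier ?L" "z \<in> carrier ?L"
    obtain a b c r t v where e: "a \<in> carrier T" "b \<in> carrier T" "c \<in> carrier T"
      "r \<in> powers T f" "t \<in> powers T f" "v \<in> powers T f"
      "x = fraction T f a r" "y = fraction T f b t" "z = fraction T f c v"
      using xyz by (metis localization_carrierE)
    show "x \<oplus>\<^bsub>?L\<^esub> y \<oplus>\<^bsub>?L\<^esub> z = x \<oplus>\<^bsub>?L\<^esub> (y \<oplus>\<^bsub>?L\<^esub> z)"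
      using e by (simp add: s m_ac l_distr r_distr a_ac)
    show "x \<oplus>\<^bsub>?L\<^esub> y \<in> carrier ?L" "x \<oplus>\<^bsub>?L\<^esub> y = y \<oplus>\<^bsub>?L\<^esub> x" "\<zero>\<^bsub>?L\<^esub> \<oplus>\<^bsub>?L\<^esub> x = x"
      using e by (simp_all add: s m_ac a_ac)
  qed (simp add: s)
  have cm: "comm_monoid ?L"
  proof (rule comm_monoidI)
    fix x y z assume xyz: "x \<in> carrier ?L" "y \<in> carrier ?L" "z \<in> carrier ?L"
    obtain a b c r t v where e: "a \<in> carrier T" "b \<in> carrier T" "c \<in> carrier T"
      "r \<in> powers T f" "t \<in> powers T f" "v \<in> powers T f"
      "x = fraction T f a r" "y = fraction T f b t" "z = fraction T f c v"
      using xyz by (metis localization_carrierE)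
    show "x \<otimes>\<^bsub>?L\<^esub> y \<otimes>\<^bsub>?L\<^esub> z = x \<otimes>\<^bsub>?L\<^esub> (y \<otimes>\<^bsub>?L\<^esub> z)"
      "x \<otimes>\<^bsub>?L\<^esub> y \<in> carrier ?L" "x \<otimes>\<^bsub>?L\<^esub> y = y \<otimes>\<^bsub>?L\<^esub> x" "\<one>\<^bsub>?L\<^esub> \<otimes>\<^bsub>?L\<^esub> x = x"
      using e by (simp_all add: s m_ac)
  qed (simp add: s)
  have l: "(x \<oplus>\<^bsub>?L\<^esub> y) \<otimes>\<^bsub>?L\<^esub> z = x \<otimes>\<^bsub>?L\<^esub> z \<oplus>\<^bsub>?L\<^esub> y \<otimes>\<^bsub>?L\<^esub> z"
    "\<zero>\<^bsub>?L\<^esub> \<otimes>\<^bsub>?L\<^esub> x = \<zero>\<^bsub>?L\<^esub>"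
    if xyz: "x \<in> carrier ?L" "y \<in> carrier ?L" "z \<in> carrier ?L" for x y z
  proof -
    obtain a b c r t v where e: "a \<in> carrier T" "b \<in> carrier T" "c \<in> carrier T"
      "r \<in> powers T f" "t \<in> powers T f" "v \<in> powers T f"
      "x = fraction T f a r" "y = fraction T f b t" "z = fraction T f c v"
      using xyz by (metis localization_carrierE)
    show "(x \<oplus>\<^bsub>?L\<^esub> y) \<otimes>\<^bsub>?L\<^esub> z = x \<otimes>\<^bsub>?L\<^esub> z \<oplus>\<^bsub>?L\<^esub> y \<otimes>\<^bsub>?L\<^esub> z"
      using e by (simp add: s) (rule fraction_eqI; simp add: s m_ac l_distr r_distr)
    show "\<zero>\<^bsub>?L\<^esub> \<otimes>\<^bsub>?L\<^esub> x = \<zero>\<^bsub>?L\<^esub>"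
      using e by (simp add: s) (rule fraction_eqI; simp add: s)
  qed
  show ?thesis
  proof (intro comm_semiring.intro semiring.intro semiring_axioms.intro)
    show "abelian_monoid ?L" "comm_monoid ?L" "monoid ?L"
      using am cm comm_monoid.axioms(1) by auto
  next
    fix x y z assume xyz: "x \<in> carrier ?L" "y \<in> carrier ?L" "z \<in> carrier ?L"
    show "(x \<oplus>\<^bsub>?L\<^esub> y) \<otimes>\<^bsub>?L\<^esub> z = x \<otimes>\<^bsub>?L\<^esub> z \<oplus>\<^bsub>?L\<^esub> y \<otimes>\<^bsub>?L\<^esub> z"
      using l xyz by blast
    show "z \<otimes>\<^bsub>?L\<^esub> (x \<oplus>\<^bsub>?L\<^esub> y) = z \<otimes>\<^bsub>?L\<^esub> x \<oplus>\<^bsub>?L\<^esub> z \<otimes>\<^bsub>?L\<^esub> y"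
      using l(1)[OF xyz] xyz comm_monoid.m_comm[OF cm] abelian_monoid.a_closed[OF am] by metis
  next
    fix x assume x: "x \<in> carrier ?L"
    show "\<zero>\<^bsub>?L\<^esub> \<otimes>\<^bsub>?L\<^esub> x = \<zero>\<^bsub>?L\<^esub>" using l x by blast
    then show "x \<otimes>\<^bsub>?L\<^esub> \<zero>\<^bsub>?L\<^esub> = \<zero>\<^bsub>?L\<^esub>"
      using x comm_monoid.m_comm[OF cm] abelian_monoid.zero_closed[OF am] by metis
  qed
qed

lemma powers_dominated:
  assumes f: "f \<in> carrier T" and g: "g \<in> carrier T" and c: "c \<in> carrier T"
    and fc: "f \<otimes> c \<in> powers T g" and s: "s \<in> powers T f"
  obtains d where "d \<in> carrier T" "s \<otimes> d \<in> powers T g"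
proof -
  obtain n :: nat where n: "s = f [^] n" using s by (auto simp: powers_def)
  have "s \<otimes> c [^] n = (f \<otimes> c) [^] n" unfolding n using f c by (simp add: nat_pow_distrib)
  then show ?thesis using that[of "c [^] n"] c pow_in_powers[OF g fc] by simp
qed

lemma fraction_transfer:
  assumes f: "f \<in> carrier T" and g: "g \<in> carrier T" and c: "c \<in> carrier T"
    and fc: "f \<otimes> c \<in> powers T g"
    and a: "a \<in> carrier T" "a' \<in> carrier T" "s \<in> powers T f" "s' \<in> powers T f"
    and e: "fraction T f a s = fraction T f a' s'"
    and d: "d \<in> carrier T" "s \<otimes> d \<in> powers T g" "d' \<in> carrier T" "s' \<otimes> d' \<in> powers T g"
  shows "fraction T g (a \<otimes> d) (s \<otimes> d) = fraction T g (a' \<otimes> d') (s' \<otimes> d')"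
proof -
  obtain w where w: "w \<in> powers T f" "w \<otimes> a \<otimes> s' = w \<otimes> a' \<otimes> s"
    using e f a by (auto simp: fraction_eq_iff)
  obtain k where k: "k \<in> carrier T" "w \<otimes> k \<in> powers T g"
    using powers_dominated[OF f g c fc w(1)] .
  note cl = a(1,2) powers_closed[OF f a(3)] powers_closed[OF f a(4)] powers_closed[OF f w(1)] k(1) d(1,3)
  have "(w \<otimes> k) \<otimes> (a \<otimes> d) \<otimes> (s' \<otimes> d') = (w \<otimes> a \<otimes> s') \<otimes> (k \<otimes> d \<otimes> d')"
    using cl by (simp add: m_ac)
  also have "\<dots> = (w \<otimes> k) \<otimes> (a' \<otimes> d') \<otimes> (s \<otimes> d)"
    unfolding w(2) using cl by (simp add: m_ac)
  finally show ?thesis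
    using g k d cl by (subst fraction_eq_iff) auto
qed

lemma loc_res_ex1:
  assumes f: "f \<in> carrier T" and g: "g \<in> carrier T" and c: "c \<in> carrier T"
    and fc: "f \<otimes> c \<in> powers T g"
  shows "\<exists>!h. h \<in> semiring_hom (localization T f) (localization T g) \<and>
            h \<in> extensional (carrier (localization T f)) \<and>
            (\<forall>a \<in> carrier T. h (to_loc T f a) = to_loc T g a)" (is "\<exists>!h. ?P h")
    and "h \<in> semiring_hom (localization T f) (localization T g) \<Longrightarrow>
      (\<And>a. a \<in> carrier T \<Longrightarrow> h (to_loc T f a) = to_loc T g a) \<Longrightarrow>
      a \<in> carrier T \<Longrightarrow> s \<in> powers T f \<Longrightarrow> d \<in> carrier T \<Longrightarrow> s \<otimes> d \<in> powers T g \<Longrightarrow>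
      h (fraction T f a s) = fraction T g (a \<otimes> d) (s \<otimes> d)"
proof -
  let ?F = "localization T f" and ?G = "localization T g"
  interpret G: comm_semiring ?G using localization_comm_semiring[OF g] .
  note pc = powers_closed[OF f]
  show *: "h (fraction T f a s) = fraction T g (a \<otimes> d) (s \<otimes> d)"
    if h: "h \<in> semiring_hom ?F ?G" "\<And>a. a \<in> carrier T \<Longrightarrow> h (to_loc T f a) = to_loc T g a"
      and a: "a \<in> carrier T" and s: "s \<in> powers T f" and d: "d \<in> carrier T" "s \<otimes> d \<in> powers T g"
    for h a s d
  proof -
    have sc: "s \<in> carrier T" using pc[OF s] .
    have "fraction T f a s \<otimes>\<^bsub>?F\<^esub> to_loc T f s = to_loc T f a"
      using f a s sc by (simp add: mult_fraction one_in_powers) (rule fraction_eqI; simp add: one_in_powers)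
    then have "h (fraction T f a s) \<otimes>\<^bsub>?G\<^esub> to_loc T g s = to_loc T g a"
      using ring_hom_mult[of h ?F ?G "fraction T f a s" "to_loc T f s"] h a s sc
      by (simp add: semiring_hom_def fraction_closed one_in_powers)
    moreover have hc: "h (fraction T f a s) \<in> carrier ?G"
      using h(1) fraction_closed[OF a s] unfolding semiring_hom_def by (auto dest: ring_hom_closed)
    moreover have dc: "fraction T g d (s \<otimes> d) \<in> carrier ?G" "to_loc T g s \<in> carrier ?G"
      using d sc by (auto intro: fraction_closed one_in_powers)
    moreover have "to_loc T g s \<otimes>\<^bsub>?G\<^esub> fraction T g d (s \<otimes> d) = \<one>\<^bsub>?G\<^esub>"
      using g d sc by (simp add: mult_fraction one_in_powers localization_one)
        (rule fraction_eqI; simp add: one_in_powers)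
    ultimately have "h (fraction T f a s) = to_loc T g a \<otimes>\<^bsub>?G\<^esub> fraction T g d (s \<otimes> d)"
      using G.m_assoc[of "h (fraction T f a s)" "to_loc T g s" "fraction T g d (s \<otimes> d)"] G.r_one
      by simp
    then show ?thesis using g a d by (simp add: mult_fraction one_in_powers powers_closed[OF g])
  qed
  define H where "H = restrict (\<lambda>x. \<Union>{fraction T g (a \<otimes> d) (s \<otimes> d) |a s d.
      (a, s) \<in> x \<and> d \<in> carrier T \<and> s \<otimes> d \<in> powers T g}) (carrier ?F)"
  have H: "H (fraction T f a s) = fraction T g (a \<otimes> d) (s \<otimes> d)"
    if a: "a \<in> carrier T" and s: "s \<in> powers T f" and d: "d \<in> carrier T" "s \<otimes> d \<in> powers T g" for a s d
  proof -
    have "{fraction T g (a' \<otimes> d') (s' \<otimes> d') |a' s' d'.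
      (a', s') \<in> fraction T f a s \<and> d' \<in> carrier T \<and> s' \<otimes> d' \<in> powers T g} =
      {fraction T g (a \<otimes> d) (s \<otimes> d)}" (is "?S = _")
    proof (intro equalityI subsetI)
      fix y assume "y \<in> ?S"
      then obtain a' s' d' where *: "(a', s') \<in> fraction T f a s" "d' \<in> carrier T"
        "s' \<otimes> d' \<in> powers T g" "y = fraction T g (a' \<otimes> d') (s' \<otimes> d')" by blast
      show "y \<in> {fraction T g (a \<otimes> d) (s \<otimes> d)}"
        using fraction_transfer[OF f g c fc _ a _ s _ *(2,3) d] in_fraction_eq[OF f a s *(1)] *(4) by simp
    next
      fix y assume "y \<in> {fraction T g (a \<otimes> d) (s \<otimes> d)}"
      then show "y \<in> ?S" using self_in_fraction[OF f a s] d by blast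
    qed
    then show ?thesis using fraction_closed[OF a s] by (simp add: H_def)
  qed
  have H1: "H (to_loc T f a) = to_loc T g a" if "a \<in> carrier T" for a
    using H[of a \<one> \<one>] that by (simp add: one_in_powers)
  have Hhom: "H \<in> semiring_hom ?F ?G"
  proof -
    have "H \<in> ring_hom ?F ?G"
    proof (rule ring_hom_memI)
      fix x assume "x \<in> carrier ?F"
      then obtain a s where x: "a \<in> carrier T" "s \<in> powers T f" "x = fraction T f a s"
        by (rule localization_carrierE)
      obtain d where d: "d \<in> carrier T" "s \<otimes> d \<in> powers T g"
        using powers_dominated[OF f g c fc x(2)] .
      show "H x \<in> carrier ?G" using x d H by (simp add: fraction_closed)
      fix y assume "y \<in> carrier ?F"
      then obtain b t where y: "b \<in> carrier T" "t \<in> powers T f" "y = fraction T f b t"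
        by (rule localization_carrierE)
      obtain e where e: "e \<in> carrier T" "t \<otimes> e \<in> powers T g"
        using powers_dominated[OF f g c fc y(2)] .
      note cl = x(1) y(1) pc[OF x(2)] pc[OF y(2)] d(1) e(1)
      have eq: "(s \<otimes> t) \<otimes> (d \<otimes> e) = (s \<otimes> d) \<otimes> (t \<otimes> e)" using cl by (simp add: m_ac)
      have de: "d \<otimes> e \<in> carrier T" "(s \<otimes> t) \<otimes> (d \<otimes> e) \<in> powers T g"
        unfolding eq using d e mult_in_powers[OF g] by auto
      have "H (x \<otimes>\<^bsub>?F\<^esub> y) = fraction T g ((a \<otimes> b) \<otimes> (d \<otimes> e)) ((s \<otimes> t) \<otimes> (d \<otimes> e))"
        unfolding x(3) y(3) using x y f de by (simp add: mult_fraction H mult_in_powers)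
      also have "\<dots> = H x \<otimes>\<^bsub>?G\<^esub> H y"
        unfolding x(3) y(3) eq using cl x y g d e
        by (simp add: H mult_fraction) (simp add: m_ac)
      finally show "H (x \<otimes>\<^bsub>?F\<^esub> y) = H x \<otimes>\<^bsub>?G\<^esub> H y" .
      have "H (x \<oplus>\<^bsub>?F\<^esub> y) = fraction T g ((a \<otimes> t \<oplus> b \<otimes> s) \<otimes> (d \<otimes> e)) ((s \<otimes> t) \<otimes> (d \<otimes> e))"
        unfolding x(3) y(3) using x y f de cl by (simp add: add_fraction H mult_in_powers)
      also have "\<dots> = H x \<oplus>\<^bsub>?G\<^esub> H y"
        unfolding x(3) y(3) eq using cl x y g d e
        by (simp add: H add_fraction) (simp add: m_ac l_distr r_distr)
      finally show "H (x \<oplus>\<^bsub>?F\<^esub> y) = H x \<oplus>\<^bsub>?G\<^esub> H y" .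
    next
      show "H \<one>\<^bsub>?F\<^esub> = \<one>\<^bsub>?G\<^esub>" by (simp add: localization_one H1)
    qed
    then show ?thesis by (simp add: semiring_hom_def localization_zero H1)
  qed
  show "\<exists>!h. ?P h"
  proof (rule ex1I[of _ H])
    show "?P H" using Hhom H1 by (simp add: H_def)
    fix h assume h: "?P h"
    show "h = H"
    proof (rule extensionalityI[of _ "carrier ?F"])
      fix x assume "x \<in> carrier ?F"
      then obtain a s where x: "a \<in> carrier T" "s \<in> powers T f" "x = fraction T f a s"
        by (rule localization_carrierE)
      obtain d where d: "d \<in> carrier T" "s \<otimes> d \<in> powers T g"
        using powers_dominated[OF f g c fc x(2)] .
      show "h x = H x" unfolding x(3) using *[of h a s d] H[of a s d] h x d by simp
    qed (use h in \<open>auto simp: H_def\<close>)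
  qed
qed

lemma loc_res:
  assumes f: "f \<in> carrier T" and g: "g \<in> carrier T" and c: "c \<in> carrier T"
    and fc: "f \<otimes> c \<in> powers T g"
  shows loc_res_hom: "loc_res T f g \<in> semiring_hom (localization T f) (localization T g)"
    and loc_res_to_loc: "a \<in> carrier T \<Longrightarrow> loc_res T f g (to_loc T f a) = to_loc T g a"
    and loc_res_fraction: "a \<in> carrier T \<Longrightarrow> s \<in> powers T f \<Longrightarrow> d \<in> carrier T \<Longrightarrow>
      s \<otimes> d \<in> powers T g \<Longrightarrow> loc_res T f g (fraction T f a s) = fraction T g (a \<otimes> d) (s \<otimes> d)"
proof -
  note 1 = theI'[OF loc_res_ex1(1)[OF assms], folded loc_res_def]
  then show "loc_res T f g \<in> semiring_hom (localization T f) (localization T g)"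
    and "a \<in> carrier T \<Longrightarrow> loc_res T f g (to_loc T f a) = to_loc T g a" by auto
  show "a \<in> carrier T \<Longrightarrow> s \<in> powers T f \<Longrightarrow> d \<in> carrier T \<Longrightarrow>
      s \<otimes> d \<in> powers T g \<Longrightarrow> loc_res T f g (fraction T f a s) = fraction T g (a \<otimes> d) (s \<otimes> d)"
    using loc_res_ex1(2)[OF assms, of "loc_res T f g"] 1 by auto
qed

end

context gamma_semiring
begin

lemma u_Units: "\<gamma> \<in> carrier \<Gamma> \<Longrightarrow> u \<gamma> \<in> Units T"
  using hom_in_carrier[OF u_hom] by (simp add: units_of_carrier)

lemma u_closed: "\<gamma> \<in> carrier \<Gamma> \<Longrightarrow> u \<gamma> \<in> carrier T"
  using u_Units by (rule Units_closed)

lemma u_one: "u \<one>\<^bsub>\<Gamma>\<^esub> = \<one>"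
  using hom_one[OF u_hom] \<Gamma>.is_group units_group by (simp add: units_of_one)

lemma gamma_ideal_iff:
  "gamma_ideal \<Gamma> T u I \<longleftrightarrow> I \<subseteq> carrier T \<and> \<zero> \<in> I \<and> (\<forall>a \<in> I. \<forall>b \<in> I. a \<oplus> b \<in> I) \<and>
     (\<forall>a \<in> I. \<forall>t \<in> carrier T. a \<otimes> t \<in> I)" (is "?L \<longleftrightarrow> ?R")
proof
  assume L: ?L
  then have 1: "I \<subseteq> carrier T" "\<zero> \<in> I" "\<forall>a \<in> I. \<forall>b \<in> I. a \<oplus> b \<in> I"
    by (auto simp: gamma_ideal_def submonoid_def)
  have "a \<otimes> t \<in> I" if "a \<in> I" "t \<in> carrier T" for a t
  proof -
    have "ternary T u \<one>\<^bsub>\<Gamma>\<^esub> a t \<one> \<in> I"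
      using L that unfolding gamma_ideal_def by (meson \<Gamma>.one_closed one_closed)
    then show ?thesis using that 1 by (simp add: ternary_def u_one subsetD)
  qed
  then show ?R using 1 by blast
next
  assume R: ?R
  have "ternary T u \<gamma> a b c \<in> I" if "a \<in> I" "b \<in> carrier T" "c \<in> carrier T" "\<gamma> \<in> carrier \<Gamma>" for a b c \<gamma>
    unfolding ternary_def using R that u_closed by simp
  then show ?L using R by (simp add: gamma_ideal_def submonoid_def)
qed

lemma Spec_iff:
  "P \<in> Spec \<Gamma> T u \<longleftrightarrow> gamma_ideal \<Gamma> T u P \<and> \<one> \<notin> P \<and>
     (\<forall>a \<in> carrier T. \<forall>b \<in> carrier T. a \<otimes> b \<in> P \<longrightarrow> a \<in> P \<or> b \<in> P)" (is "?L \<longleftrightarrow> ?R")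
proof
  assume L: ?L
  then have I: "gamma_ideal \<Gamma> T u P" and ne: "P \<noteq> carrier T"
    by (auto simp: Spec_def prime_gamma_ideal_def)
  have pr: "a \<in> P \<or> b \<in> P \<or> c \<in> P" if "a \<in> carrier T" "b \<in> carrier T" "c \<in> carrier T"
    "\<gamma> \<in> carrier \<Gamma>" "ternary T u \<gamma> a b c \<in> P" for a b c \<gamma>
    using L that unfolding Spec_def prime_gamma_ideal_def by blast
  have one: "\<one> \<notin> P"
  proof
    assume "\<one> \<in> P"
    then have "\<forall>t \<in> carrier T. \<one> \<otimes> t \<in> P" "P \<subseteq> carrier T" using I unfolding gamma_ideal_iff by blast+
    then show False using ne by auto
  qed
  have "a \<in> P \<or> b \<in> P" if "a \<in> carrier T" "b \<in> carrier T" "a \<otimes> b \<in> P" for a b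
  proof -
    have "ternary T u \<one>\<^bsub>\<Gamma>\<^esub> a b \<one> \<in> P" using that by (simp add: ternary_def u_one)
    then show ?thesis
      using pr[of a b \<one> "\<one>\<^bsub>\<Gamma>\<^esub>"] that one by simp
  qed
  then show ?R using I one by blast
next
  assume R: ?R
  have "a \<in> P \<or> b \<in> P \<or> c \<in> P" if h: "a \<in> carrier T" "b \<in> carrier T" "c \<in> carrier T" "\<gamma> \<in> carrier \<Gamma>"
    "ternary T u \<gamma> a b c \<in> P" for a b c \<gamma>
  proof -
    have "a \<otimes> b \<otimes> c \<otimes> u \<gamma> \<otimes> inv\<^bsub>T\<^esub> (u \<gamma>) \<in> P"
      using R h(5) Units_inv_closed[OF u_Units[OF h(4)]] by (simp add: gamma_ideal_iff ternary_def)
    then have "a \<otimes> b \<otimes> c \<in> P"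
      using h u_Units[OF h(4)] u_closed[OF h(4)] by (simp add: m_assoc)
    then have "a \<otimes> b \<in> P \<or> c \<in> P" using R h m_closed[OF h(1,2)] by simp
    then show ?thesis using R h by auto
  qed
  then show ?L using R by (auto simp: Spec_def prime_gamma_ideal_def)
qed

lemma Spec_subset: "P \<in> Spec \<Gamma> T u \<Longrightarrow> P \<subseteq> carrier T"
  by (simp add: Spec_iff gamma_ideal_iff)

lemma prime_avoiding_powers:
  assumes I: "gamma_ideal \<Gamma> T u I" and g: "g \<in> carrier T" and disj: "I \<inter> powers T g = {}"
  obtains P where "P \<in> Spec \<Gamma> T u" "I \<subseteq> P" "g \<notin> P"
proof -
  define \<A> where "\<A> = {J. gamma_ideal \<Gamma> T u J \<and> I \<subseteq> J \<and> J \<inter> powers T g = {}}"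
  have "\<exists>M \<in> \<A>. \<forall>J \<in> \<A>. M \<subseteq> J \<longrightarrow> J = M"
  proof (rule subset_Zorn_nonempty)
    show "\<A> \<noteq> {}" using I disj by (auto simp: \<A>_def)
    fix \<C> assume C: "\<C> \<noteq> {}" "subset.chain \<A> \<C>"
    have CA: "\<C> \<subseteq> \<A>" and lin: "\<And>x y. x \<in> \<C> \<Longrightarrow> y \<in> \<C> \<Longrightarrow> x \<subseteq> y \<or> y \<subseteq> x"
      using C(2) by (auto simp: subset_chain_def)
    have id: "J \<subseteq> carrier T" "\<zero> \<in> J" "\<And>a b. a \<in> J \<Longrightarrow> b \<in> J \<Longrightarrow> a \<oplus> b \<in> J"
      "\<And>a t. a \<in> J \<Longrightarrow> t \<in> carrier T \<Longrightarrow> a \<otimes> t \<in> J" "I \<subseteq> J" "J \<inter> powers T g = {}" if "J \<in> \<C>" for J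
      using that CA by (auto simp: \<A>_def gamma_ideal_iff)
    have "a \<oplus> b \<in> \<Union>\<C>" if ab: "a \<in> \<Union>\<C>" "b \<in> \<Union>\<C>" for a b
    proof -
      obtain J K where JK: "J \<in> \<C>" "a \<in> J" "K \<in> \<C>" "b \<in> K"
        using ab unfolding Union_iff by meson
      then have "\<exists>L \<in> \<C>. a \<in> L \<and> b \<in> L" using lin[of J K] by auto
      then show ?thesis using id(3) by blast
    qed
    moreover have "\<Union>\<C> \<subseteq> carrier T" using id(1) by blast
    moreover have "\<zero> \<in> \<Union>\<C>" using C(1) id(2) by blast
    moreover have "a \<otimes> t \<in> \<Union>\<C>" if "a \<in> \<Union>\<C>" "t \<in> carrier T" for a t
      using id(4) that by blast
    ultimately have "gamma_ideal \<Gamma> T u (\<Union>\<C>)" by (simp add: gamma_ideal_iff)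
    moreover have "I \<subseteq> \<Union>\<C>" using C(1) id(5) by blast
    moreover have "\<Union>\<C> \<inter> powers T g = {}" using id(6) by blast
    ultimately show "\<Union>\<C> \<in> \<A>" by (simp add: \<A>_def)
  qed
  then obtain M where M: "M \<in> \<A>" and max: "\<And>J. J \<in> \<A> \<Longrightarrow> M \<subseteq> J \<Longrightarrow> J = M" by blast
  have Mi: "gamma_ideal \<Gamma> T u M" and IM: "I \<subseteq> M" and Md: "M \<inter> powers T g = {}"
    using M by (auto simp: \<A>_def)
  have Mc: "M \<subseteq> carrier T" and M0: "\<zero> \<in> M" and Ma: "\<And>a b. a \<in> M \<Longrightarrow> b \<in> M \<Longrightarrow> a \<oplus> b \<in> M"
    and Mm: "\<And>a t. a \<in> M \<Longrightarrow> t \<in> carrier T \<Longrightarrow> a \<otimes> t \<in> M"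
    using Mi by (auto simp: gamma_ideal_iff)
  have ext: "\<exists>m \<in> M. \<exists>t \<in> carrier T. m \<oplus> a \<otimes> t \<in> powers T g" if a: "a \<in> carrier T" "a \<notin> M" for a
  proof (rule ccontr)
    assume no: "\<not> ?thesis"
    define J where "J = {m \<oplus> a \<otimes> t |m t. m \<in> M \<and> t \<in> carrier T}"
    have "J \<in> \<A>"
    proof -
      have 1: "J \<subseteq> carrier T" using Mc a by (auto simp: J_def)
      have MJ: "M \<subseteq> J"
      proof
        fix m assume "m \<in> M"
        then have "m = m \<oplus> a \<otimes> \<zero>" using a Mc by auto
        then show "m \<in> J" unfolding J_def using \<open>m \<in> M\<close> by blast
      qed
      have 2: "x \<oplus> y \<in> J" if xy: "x \<in> J" "y \<in> J" for x y
      proof -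
        obtain m t n s where e: "m \<in> M" "n \<in> M" "t \<in> carrier T" "s \<in> carrier T"
          "x = m \<oplus> a \<otimes> t" "y = n \<oplus> a \<otimes> s" using xy unfolding J_def by blast
        then have "m \<in> carrier T" "n \<in> carrier T" using Mc by auto
        then have "x \<oplus> y = (m \<oplus> n) \<oplus> a \<otimes> (t \<oplus> s)" using e a by (simp add: r_distr a_ac)
        then show ?thesis unfolding J_def using e Ma by blast
      qed
      have 3: "x \<otimes> y \<in> J" if xy: "x \<in> J" "y \<in> carrier T" for x y
      proof -
        obtain m t where e: "m \<in> M" "t \<in> carrier T" "x = m \<oplus> a \<otimes> t" using xy unfolding J_def by blast
        then have "m \<in> carrier T" using Mc by auto
        then have "x \<otimes> y = m \<otimes> y \<oplus> a \<otimes> (t \<otimes> y)"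
          using e a xy(2) by (simp add: l_distr m_assoc)
        then show ?thesis unfolding J_def using e Mm xy by blast
      qed
      have "J \<inter> powers T g = {}" using no unfolding J_def by blast
      moreover have "gamma_ideal \<Gamma> T u J" using 1 2 3 MJ M0 by (auto simp: gamma_ideal_iff)
      moreover have "I \<subseteq> J" using MJ IM by (rule order_trans[rotated])
      ultimately show ?thesis by (simp add: \<A>_def)
    qed
    moreover have "M \<subseteq> J"
    proof
      fix m assume "m \<in> M"
      then have "m = m \<oplus> a \<otimes> \<zero>" using a Mc by auto
      then show "m \<in> J" unfolding J_def using \<open>m \<in> M\<close> by blast
    qed
    ultimately have "J = M" using max by blast
    moreover have "a = \<zero> \<oplus> a \<otimes> \<one>" using a by simp
    then have "a \<in> J" unfolding J_def using M0 by blast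
    ultimately show False using a by blast
  qed
  have "a \<in> M \<or> b \<in> M" if ab: "a \<in> carrier T" "b \<in> carrier T" "a \<otimes> b \<in> M" for a b
  proof (rule ccontr)
    assume "\<not> ?thesis"
    then obtain m t n s where e: "m \<in> M" "n \<in> M" "t \<in> carrier T" "s \<in> carrier T"
      "m \<oplus> a \<otimes> t \<in> powers T g" "n \<oplus> b \<otimes> s \<in> powers T g"
      using ext[of a] ext[of b] ab by blast
    have cl: "m \<in> carrier T" "n \<in> carrier T" using e Mc by auto
    have "(m \<oplus> a \<otimes> t) \<otimes> (n \<oplus> b \<otimes> s) = m \<otimes> (n \<oplus> b \<otimes> s) \<oplus> (n \<otimes> (a \<otimes> t) \<oplus> (a \<otimes> b) \<otimes> (t \<otimes> s))"
      using cl ab e(3,4) by (simp add: l_distr r_distr m_ac a_ac)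
    also have "\<dots> \<in> M"
      by (intro Ma Mm[OF e(1)] Mm[OF e(2)] Mm[OF ab(3)]) (use cl ab(1,2) e(3,4) in auto)
    finally show False using mult_in_powers[OF g e(5,6)] Md by blast
  qed
  moreover have "\<one> \<notin> M" using Md one_in_powers by blast
  ultimately have "M \<in> Spec \<Gamma> T u" using Mi by (auto simp: Spec_iff)
  moreover have "g \<notin> M" using Md self_in_powers[OF g] by blast
  ultimately show ?thesis using that IM by blast
qed

lemma basic_open_subset_dominated:
  assumes f: "f \<in> carrier T" and g: "g \<in> carrier T" and sub: "basic_open \<Gamma> T u g \<subseteq> basic_open \<Gamma> T u f"
  obtains c where "c \<in> carrier T" "f \<otimes> c \<in> powers T g"
proof -
  let ?I = "{f \<otimes> t |t. t \<in> carrier T}"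
  have "gamma_ideal \<Gamma> T u ?I"
    unfolding gamma_ideal_iff
  proof (intro conjI ballI)
    show "?I \<subseteq> carrier T" using f by auto
    show "\<zero> \<in> ?I" using f by (auto intro!: exI[of _ \<zero>])
    fix a assume "a \<in> ?I"
    then obtain t where t: "t \<in> carrier T" "a = f \<otimes> t" by blast
    { fix b assume "b \<in> ?I"
      then obtain s where s: "s \<in> carrier T" "b = f \<otimes> s" by blast
      have "a \<oplus> b = f \<otimes> (t \<oplus> s)" using f t s by (simp add: r_distr)
      then show "a \<oplus> b \<in> ?I" using t s by blast }
    { fix s assume s: "s \<in> carrier T"
      have "a \<otimes> s = f \<otimes> (t \<otimes> s)" using f t s by (simp add: m_ac)
      then show "a \<otimes> s \<in> ?I" using t s by blast }
  qed
  moreover have "f \<in> ?I" using f by (auto intro!: exI[of _ \<one>])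
  ultimately have "?I \<inter> powers T g \<noteq> {}"
    using prime_avoiding_powers[of ?I g] g sub unfolding basic_open_def by blast
  then show ?thesis using that by blast
qed

lemma basic_open_mult:
  "f \<in> carrier T \<Longrightarrow> g \<in> carrier T \<Longrightarrow>
    basic_open \<Gamma> T u (f \<otimes> g) = basic_open \<Gamma> T u f \<inter> basic_open \<Gamma> T u g"
proof -
  assume fg: "f \<in> carrier T" "g \<in> carrier T"
  have "f \<otimes> g \<in> P \<longleftrightarrow> f \<in> P \<or> g \<in> P" if P: "P \<in> Spec \<Gamma> T u" for P
  proof
    show "f \<otimes> g \<in> P \<Longrightarrow> f \<in> P \<or> g \<in> P" using P fg by (simp add: Spec_iff)
    assume "f \<in> P \<or> g \<in> P"
    then have "f \<otimes> g \<in> P \<or> g \<otimes> f \<in> P" using P fg by (auto simp: Spec_iff gamma_ideal_iff)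
    then show "f \<otimes> g \<in> P" by (simp add: m_comm[OF fg(2,1)])
  qed
  then show ?thesis by (auto simp: basic_open_def)
qed

lemma vanishing_Int:
  assumes "gamma_ideal \<Gamma> T u I" "gamma_ideal \<Gamma> T u J"
  shows "gamma_ideal \<Gamma> T u (I \<inter> J)"
    "vanishing \<Gamma> T u (I \<inter> J) = vanishing \<Gamma> T u I \<union> vanishing \<Gamma> T u J"
proof -
  show "gamma_ideal \<Gamma> T u (I \<inter> J)" using assms by (auto simp: gamma_ideal_iff)
  show "vanishing \<Gamma> T u (I \<inter> J) = vanishing \<Gamma> T u I \<union> vanishing \<Gamma> T u J"
  proof (intro equalityI subsetI)
    fix P assume P: "P \<in> vanishing \<Gamma> T u (I \<inter> J)"
    show "P \<in> vanishing \<Gamma> T u I \<union> vanishing \<Gamma> T u J"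
    proof (rule ccontr)
      assume "\<not> ?thesis"
      then obtain a b where ab: "a \<in> I" "a \<notin> P" "b \<in> J" "b \<notin> P"
        using P by (auto simp: vanishing_def)
      then have cl: "a \<in> carrier T" "b \<in> carrier T" using assms by (auto simp: gamma_ideal_iff)
      then have "a \<otimes> b \<in> I" "b \<otimes> a \<in> J" using ab assms by (auto simp: gamma_ideal_iff)
      then have "a \<otimes> b \<in> P" using P m_comm cl by (auto simp: vanishing_def)
      then show False using ab cl P by (auto simp: vanishing_def Spec_iff)
    qed
  qed (auto simp: vanishing_def)
qed

lemma istopology_spec:
  "istopology (\<lambda>U. \<exists>I. gamma_ideal \<Gamma> T u I \<and> U = Spec \<Gamma> T u - vanishing \<Gamma> T u I)" (is "istopology ?op")
  unfolding istopology_def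
proof (intro conjI allI impI)
  fix A B assume "?op A" "?op B"
  then obtain I J where "gamma_ideal \<Gamma> T u I" "A = Spec \<Gamma> T u - vanishing \<Gamma> T u I"
    "gamma_ideal \<Gamma> T u J" "B = Spec \<Gamma> T u - vanishing \<Gamma> T u J" by blast
  then show "?op (A \<inter> B)" using vanishing_Int[of I J] by (intro exI[of _ "I \<inter> J"]) auto
next
  fix \<K> assume K: "\<forall>K \<in> \<K>. ?op K"
  define \<I> where "\<I> = {I. gamma_ideal \<Gamma> T u I \<and> Spec \<Gamma> T u - vanishing \<Gamma> T u I \<in> \<K>}"
  define J where "J = \<Inter>{I. gamma_ideal \<Gamma> T u I \<and> \<Union>\<I> \<subseteq> I}"
  have car: "gamma_ideal \<Gamma> T u (carrier T)" by (auto simp: gamma_ideal_iff)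
  have "\<Union>\<I> \<subseteq> carrier T" by (auto simp: \<I>_def gamma_ideal_iff)
  then have Ji: "gamma_ideal \<Gamma> T u J" and IJ: "\<Union>\<I> \<subseteq> J"
    using car unfolding J_def by (auto simp: gamma_ideal_iff)
  have least: "\<Union>\<I> \<subseteq> P \<longleftrightarrow> J \<subseteq> P" if "P \<in> Spec \<Gamma> T u" for P
    using that IJ unfolding J_def by (auto simp: Spec_iff)
  have "\<Union>\<K> = Spec \<Gamma> T u - vanishing \<Gamma> T u J"
  proof (intro equalityI subsetI)
    fix P assume "P \<in> \<Union>\<K>"
    then obtain A I where A: "A \<in> \<K>" "P \<in> A" "gamma_ideal \<Gamma> T u I"
      "A = Spec \<Gamma> T u - vanishing \<Gamma> T u I" using K by (meson Union_iff)
    then have "I \<in> \<I>" "P \<in> Spec \<Gamma> T u" "\<not> I \<subseteq> P"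
      by (auto simp: \<I>_def vanishing_def)
    then show "P \<in> Spec \<Gamma> T u - vanishing \<Gamma> T u J" using least unfolding vanishing_def by blast
  next
    fix P assume P: "P \<in> Spec \<Gamma> T u - vanishing \<Gamma> T u J"
    then obtain I where I: "I \<in> \<I>" "\<not> I \<subseteq> P" using least[of P] by (auto simp: vanishing_def)
    then have "P \<in> Spec \<Gamma> T u - vanishing \<Gamma> T u I" using P by (auto simp: vanishing_def)
    then show "P \<in> \<Union>\<K>" using I unfolding \<I>_def by blast
  qed
  then show "?op (\<Union>\<K>)" using Ji by blast
qed

lemma openin_spec_topology:
  "openin (spec_topology \<Gamma> T u) U \<longleftrightarrow>
    (\<exists>I. gamma_ideal \<Gamma> T u I \<and> U = Spec \<Gamma> T u - vanishing \<Gamma> T u I)"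
  unfolding spec_topology_def topology_inverse'[OF istopology_spec] ..

lemma topspace_spec_topology: "topspace (spec_topology \<Gamma> T u) = Spec \<Gamma> T u"
proof (rule equalityI)
  show "topspace (spec_topology \<Gamma> T u) \<subseteq> Spec \<Gamma> T u"
    unfolding topspace_def openin_spec_topology by blast
  have "gamma_ideal \<Gamma> T u (carrier T)" by (auto simp: gamma_ideal_iff)
  moreover have "vanishing \<Gamma> T u (carrier T) = {}" by (auto simp: vanishing_def Spec_iff)
  ultimately have "openin (spec_topology \<Gamma> T u) (Spec \<Gamma> T u)" unfolding openin_spec_topology by blast
  then show "Spec \<Gamma> T u \<subseteq> topspace (spec_topology \<Gamma> T u)" by (rule openin_subset)
qed

lemma openin_basic:
  assumes "openin (spec_topology \<Gamma> T u) U" "P \<in> U"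
  obtains f where "f \<in> carrier T" "P \<in> basic_open \<Gamma> T u f" "basic_open \<Gamma> T u f \<subseteq> U"
proof -
  obtain I where I: "gamma_ideal \<Gamma> T u I" "U = Spec \<Gamma> T u - vanishing \<Gamma> T u I"
    using assms openin_spec_topology by blast
  then obtain f where "f \<in> I" "f \<notin> P" using assms(2) by (auto simp: vanishing_def)
  then show ?thesis using that[of f] I assms(2)
    by (auto simp: vanishing_def basic_open_def gamma_ideal_iff)
qed

abbreviation (input) D where "D \<equiv> basic_open \<Gamma> T u"

lemma basic_res:
  assumes f: "f \<in> carrier T" and g: "g \<in> carrier T" and sub: "D g \<subseteq> D f"
  shows basic_res_hom: "loc_res T f g \<in> semiring_hom (localization T f) (localization T g)"
    and basic_res_to_loc: "a \<in> carrier T \<Longrightarrow> loc_res T f g (to_loc T f a) = to_loc T g a"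
    and basic_res_fraction: "a \<in> carrier T \<Longrightarrow> s \<in> powers T f \<Longrightarrow> d \<in> carrier T \<Longrightarrow>
      s \<otimes> d \<in> powers T g \<Longrightarrow> loc_res T f g (fraction T f a s) = fraction T g (a \<otimes> d) (s \<otimes> d)"
    and basic_dom: "s \<in> powers T f \<Longrightarrow> \<exists>d \<in> carrier T. s \<otimes> d \<in> powers T g"
proof -
  obtain c where c: "c \<in> carrier T" "f \<otimes> c \<in> powers T g"
    using basic_open_subset_dominated[OF assms] .
  note r = loc_res[OF f g c]
  show "loc_res T f g \<in> semiring_hom (localization T f) (localization T g)" by (rule r(1))
  show "a \<in> carrier T \<Longrightarrow> loc_res T f g (to_loc T f a) = to_loc T g a" by (rule r(2))
  show "a \<in> carrier T \<Longrightarrow> s \<in> powers T f \<Longrightarrow> d \<in> carrier T \<Longrightarrow>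
      s \<otimes> d \<in> powers T g \<Longrightarrow> loc_res T f g (fraction T f a s) = fraction T g (a \<otimes> d) (s \<otimes> d)"
    by (rule r(3))
  show "s \<in> powers T f \<Longrightarrow> \<exists>d \<in> carrier T. s \<otimes> d \<in> powers T g"
    using powers_dominated[OF f g c] by metis
qed

lemma basic_res_closed:
  assumes "f \<in> carrier T" "g \<in> carrier T" "D g \<subseteq> D f" "x \<in> carrier (localization T f)"
  shows "loc_res T f g x \<in> carrier (localization T g)"
  using basic_res_hom[OF assms(1-3)] assms(4) by (auto simp: semiring_hom_def dest: ring_hom_closed)

lemma basic_res_id:
  assumes f: "f \<in> carrier T" and x: "x \<in> carrier (localization T f)"
  shows "loc_res T f f x = x"
proof -
  obtain a s where e: "a \<in> carrier T" "s \<in> powers T f" "x = fraction T f a s"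
    using x by (rule localization_carrierE)
  then show ?thesis
    using basic_res_fraction[OF f f subset_refl e(1,2), of \<one>] powers_closed[OF f e(2)] by simp
qed

lemma basic_res_trans:
  assumes f: "f \<in> carrier T" and g: "g \<in> carrier T" and h: "h \<in> carrier T"
    and gf: "D g \<subseteq> D f" and hg: "D h \<subseteq> D g" and x: "x \<in> carrier (localization T f)"
  shows "loc_res T g h (loc_res T f g x) = loc_res T f h x"
proof -
  obtain a s where e: "a \<in> carrier T" "s \<in> powers T f" "x = fraction T f a s"
    using x by (rule localization_carrierE)
  obtain d where d: "d \<in> carrier T" "s \<otimes> d \<in> powers T g" using basic_dom[OF f g gf e(2)] by blast
  obtain k where k: "k \<in> carrier T" "(s \<otimes> d) \<otimes> k \<in> powers T h" using basic_dom[OF g h hg d(2)] by blast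
  have sc: "s \<in> carrier T" using powers_closed[OF f e(2)] .
  have hf: "D h \<subseteq> D f" using gf hg by blast
  have "loc_res T g h (loc_res T f g x) = fraction T h ((a \<otimes> d) \<otimes> k) ((s \<otimes> d) \<otimes> k)"
    unfolding e(3) basic_res_fraction[OF f g gf e(1,2) d]
    using basic_res_fraction[OF g h hg _ d(2) k] e(1) d(1) by simp
  also have "\<dots> = loc_res T f h x"
    unfolding e(3) using basic_res_fraction[OF f h hf e(1,2), of "d \<otimes> k"] e(1) d k sc
    by (simp add: m_assoc)
  finally show ?thesis .
qed

lemma powers_notin_prime:
  assumes P: "P \<in> Spec \<Gamma> T u" and g: "g \<in> carrier T" "g \<notin> P" and s: "s \<in> powers T g"
  shows "s \<notin> P"
proof -
  have "g [^] n \<notin> P" for n :: nat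
    using P g by (induction n) (auto simp: Spec_iff)
  then show ?thesis using s by (auto simp: powers_def)
qed

lemma loc_locality:
  assumes f: "f \<in> carrier T" and G: "G \<subseteq> carrier T" and sub: "\<And>g. g \<in> G \<Longrightarrow> D g \<subseteq> D f"
    and cov: "D f \<subseteq> (\<Union>g \<in> G. D g)"
    and x: "x \<in> carrier (localization T f)" and y: "y \<in> carrier (localization T f)"
    and eq: "\<And>g. g \<in> G \<Longrightarrow> loc_res T f g x = loc_res T f g y"
  shows "x = y"
proof -
  obtain a s where a: "a \<in> carrier T" and s: "s \<in> powers T f" and xe: "x = fraction T f a s"
    using x by (rule localization_carrierE)
  obtain b t where b: "b \<in> carrier T" and t: "t \<in> powers T f" and ye: "y = fraction T f b t"
    using y by (rule localization_carrierE)
  have sc: "s \<in> carrier T" and tc: "t \<in> carrier T" using powers_closed[OF f] s t by auto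
  define J where "J = {w \<in> carrier T. w \<otimes> (a \<otimes> t) = w \<otimes> (b \<otimes> s)}"
  have J: "gamma_ideal \<Gamma> T u J"
    unfolding gamma_ideal_iff
  proof (intro conjI ballI)
    show "J \<subseteq> carrier T" "\<zero> \<in> J" using a b sc tc by (auto simp: J_def)
    fix v assume v: "v \<in> J"
    { fix w assume "w \<in> J"
      then show "v \<oplus> w \<in> J" using v a b sc tc by (auto simp: J_def l_distr) }
    { fix w assume w: "w \<in> carrier T"
      have "w \<otimes> v \<otimes> (a \<otimes> t) = w \<otimes> v \<otimes> (b \<otimes> s)"
        using v w a b sc tc by (simp add: J_def m_assoc)
      then show "v \<otimes> w \<in> J" using v w m_comm[of v w] by (simp add: J_def) }
  qed
  have "J \<inter> powers T f \<noteq> {}"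
  proof
    assume "J \<inter> powers T f = {}"
    then obtain P where P: "P \<in> Spec \<Gamma> T u" "J \<subseteq> P" "f \<notin> P"
      using prime_avoiding_powers[OF J f] by blast
    then obtain g where g: "g \<in> G" "g \<notin> P" using cov by (auto simp: basic_open_def)
    have gc: "g \<in> carrier T" using g G by blast
    obtain d where d: "d \<in> carrier T" "s \<otimes> d \<in> powers T g" using basic_dom[OF f gc sub[OF g(1)] s] by blast
    obtain k where k: "k \<in> carrier T" "t \<otimes> k \<in> powers T g" using basic_dom[OF f gc sub[OF g(1)] t] by blast
    have "fraction T g (a \<otimes> d) (s \<otimes> d) = fraction T g (b \<otimes> k) (t \<otimes> k)"
      using eq[OF g(1)] unfolding xe ye
      unfolding basic_res_fraction[OF f gc sub[OF g(1)] a s d]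
        basic_res_fraction[OF f gc sub[OF g(1)] b t k] .
    then obtain w where w: "w \<in> powers T g" "w \<otimes> (a \<otimes> d) \<otimes> (t \<otimes> k) = w \<otimes> (b \<otimes> k) \<otimes> (s \<otimes> d)"
      using fraction_eq_iff[OF gc] a b d k by auto
    have wc: "w \<in> carrier T" using powers_closed[OF gc w(1)] .
    define z where "z = w \<otimes> d \<otimes> k"
    have zc: "z \<in> carrier T" using wc d k by (simp add: z_def)
    have "z \<otimes> (a \<otimes> t) = w \<otimes> (a \<otimes> d) \<otimes> (t \<otimes> k)"
      unfolding z_def using wc d(1) k(1) a tc by (simp add: m_ac)
    also have "\<dots> = z \<otimes> (b \<otimes> s)"
      unfolding w(2) z_def using wc d(1) k(1) b sc by (simp add: m_ac)
    finally have "z \<in> J" using zc by (simp add: J_def)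
    then have "z \<otimes> (s \<otimes> t) \<in> J" using J sc tc by (simp add: gamma_ideal_iff)
    moreover have "z \<otimes> (s \<otimes> t) = w \<otimes> (s \<otimes> d) \<otimes> (t \<otimes> k)"
      unfolding z_def using wc d(1) k(1) sc tc by (simp add: m_ac)
    moreover have "\<dots> \<in> powers T g" using w(1) d(2) k(2) mult_in_powers[OF gc] by simp
    ultimately show False using powers_notin_prime[OF P(1) gc g(2)] P(2) by auto
  qed
  then obtain w where w: "w \<in> powers T f" "w \<otimes> (a \<otimes> t) = w \<otimes> (b \<otimes> s)" by (auto simp: J_def)
  have "w \<otimes> a \<otimes> t = w \<otimes> b \<otimes> s"
    using w(2) powers_closed[OF f w(1)] a b sc tc by (simp add: m_assoc)
  then show ?thesis unfolding xe ye using fraction_eq_iff[OF f a b s t] w(1) by blast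
qed

lemma to_loc_cancel:
  assumes g: "g \<in> carrier T" and d: "d \<in> carrier T" and c: "c \<in> carrier T" "d \<otimes> c \<in> powers T g"
    and x: "x \<in> carrier (localization T g)" and y: "y \<in> carrier (localization T g)"
    and eq: "to_loc T g d \<otimes>\<^bsub>localization T g\<^esub> x = to_loc T g d \<otimes>\<^bsub>localization T g\<^esub> y"
  shows "x = y"
proof -
  let ?G = "localization T g"
  interpret G: comm_semiring ?G using localization_comm_semiring[OF g] .
  let ?i = "fraction T g c (d \<otimes> c)"
  have ic: "?i \<in> carrier ?G" "to_loc T g d \<in> carrier ?G"
    using c d by (auto intro: fraction_closed one_in_powers)
  have inv: "?i \<otimes>\<^bsub>?G\<^esub> to_loc T g d = \<one>\<^bsub>?G\<^esub>"
    using g c d powers_closed[OF g c(2)] m_comm[OF c(1) d]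
    by (simp add: mult_fraction one_in_powers localization_one) (rule fraction_eqI; simp add: one_in_powers)
  have "?i \<otimes>\<^bsub>?G\<^esub> (to_loc T g d \<otimes>\<^bsub>?G\<^esub> z) = z" if "z \<in> carrier ?G" for z
    using G.m_assoc[OF ic that] inv that by simp
  then show ?thesis using eq x y by metis
qed

lemma uniform_power:
  assumes h: "h \<in> carrier T" and fin: "finite F"
    and ex: "\<And>g. g \<in> F \<Longrightarrow> \<exists>N \<in> powers T h. Q N g"
    and up: "\<And>N M g. N \<in> powers T h \<Longrightarrow> M \<in> powers T h \<Longrightarrow> g \<in> F \<Longrightarrow> Q N g \<Longrightarrow> Q (N \<otimes> M) g"
  shows "\<exists>N \<in> powers T h. \<forall>g \<in> F. Q N g"
  using fin ex up
proof (induction F rule: finite_induct)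
  case empty
  then show ?case using one_in_powers by auto
next
  case (insert g F)
  then obtain N where N: "N \<in> powers T h" "\<forall>g \<in> F. Q N g" by (metis insertCI)
  obtain M where M: "M \<in> powers T h" "Q M g" using insert.prems(1)[of g] by blast
  have "Q (N \<otimes> M) g'" if g': "g' \<in> insert g F" for g'
  proof (cases "g' = g")
    case True
    have "N \<otimes> M = M \<otimes> N" using N(1) M(1) powers_closed[OF h] by (simp add: m_comm)
    then show ?thesis using insert.prems(2)[OF M(1) N(1) g'] M(2) True by simp
  next
    case False
    then show ?thesis using insert.prems(2)[OF N(1) M(1) g'] N(2) g' by simp
  qed
  then show ?case using mult_in_powers[OF h N(1) M(1)] by blast
qed

lemma finite_subcover:
  assumes f: "f \<in> carrier T" and G: "G \<subseteq> carrier T" and cov: "D f \<subseteq> (\<Union>g \<in> G. D g)"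
  obtains F where "finite F" "F \<subseteq> G" "D f \<subseteq> (\<Union>g \<in> F. D g)"
proof -
  define K where "K = {x \<in> carrier T. \<exists>F. finite F \<and> F \<subseteq> G \<and> D x \<subseteq> (\<Union>g \<in> F. D g)}"
  have Ki: "gamma_ideal \<Gamma> T u K"
    unfolding gamma_ideal_iff
  proof (intro conjI ballI)
    show "K \<subseteq> carrier T" by (auto simp: K_def)
    have "D \<zero> \<subseteq> (\<Union>g \<in> {}. D g)" by (auto simp: basic_open_def Spec_iff gamma_ideal_iff)
    then show "\<zero> \<in> K" unfolding K_def using finite.emptyI by blast
    fix x assume x: "x \<in> K"
    then obtain A where A: "finite A" "A \<subseteq> G" "D x \<subseteq> (\<Union>g \<in> A. D g)" by (auto simp: K_def)
    { fix y assume y: "y \<in> K"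
      then obtain B where B: "finite B" "B \<subseteq> G" "D y \<subseteq> (\<Union>g \<in> B. D g)" by (auto simp: K_def)
      have "D (x \<oplus> y) \<subseteq> D x \<union> D y" by (auto simp: basic_open_def Spec_iff gamma_ideal_iff)
      also have "\<dots> \<subseteq> (\<Union>g \<in> A \<union> B. D g)" using A(3) B(3) by blast
      finally have "D (x \<oplus> y) \<subseteq> (\<Union>g \<in> A \<union> B. D g)" .
      moreover have "finite (A \<union> B)" "A \<union> B \<subseteq> G" using A B by auto
      moreover have "x \<oplus> y \<in> carrier T" using x y by (auto simp: K_def)
      ultimately show "x \<oplus> y \<in> K" unfolding K_def by blast }
    { fix y assume y: "y \<in> carrier T"
      have xc: "x \<in> carrier T" using x by (auto simp: K_def)
      then have "D (x \<otimes> y) \<subseteq> (\<Union>g \<in> A. D g)" using y basic_open_mult[OF xc y] A(3) by blast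
      then show "x \<otimes> y \<in> K" unfolding K_def using A xc y by blast }
  qed
  have GK: "G \<subseteq> K"
  proof
    fix g assume "g \<in> G"
    then have "finite {g}" "{g} \<subseteq> G" "D g \<subseteq> (\<Union>g \<in> {g}. D g)" "g \<in> carrier T" using G by auto
    then show "g \<in> K" unfolding K_def by blast
  qed
  have "K \<inter> powers T f \<noteq> {}"
  proof
    assume "K \<inter> powers T f = {}"
    then obtain P where P: "P \<in> Spec \<Gamma> T u" "K \<subseteq> P" "f \<notin> P"
      using prime_avoiding_powers[OF Ki f] by metis
    then obtain g where "g \<in> G" "g \<notin> P" using cov by (auto simp: basic_open_def)
    then show False using GK P(2) by blast
  qed
  then obtain z F where z: "z \<in> powers T f" "finite F" "F \<subseteq> G" "D z \<subseteq> (\<Union>g \<in> F. D g)"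
    by (auto simp: K_def)
  have "D f \<subseteq> D z" using powers_notin_prime f z(1) by (auto simp: basic_open_def)
  then show ?thesis using that z by blast
qed

lemma mult_in_powers_mult:
  assumes "g \<in> carrier T" "h \<in> carrier T" "t \<in> powers T g"
  obtains h' where "h' \<in> powers T h" "t \<otimes> h' \<in> powers T (g \<otimes> h)"
proof -
  obtain n :: nat where n: "t = g [^] n" using assms by (auto simp: powers_def)
  have "g [^] n \<otimes> h [^] n = (g \<otimes> h) [^] n" using assms by (simp add: nat_pow_distrib)
  then show ?thesis using that[of "h [^] n"] n unfolding powers_def by blast
qed

lemma in_powers_mult:
  assumes "g \<in> carrier T" "h \<in> carrier T" "w \<in> powers T (g \<otimes> h)"
  obtains p q where "p \<in> powers T g" "q \<in> powers T h" "w = p \<otimes> q"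
proof -
  obtain n :: nat where n: "w = (g \<otimes> h) [^] n" using assms by (auto simp: powers_def)
  then have "w = g [^] n \<otimes> h [^] n" using assms by (simp add: nat_pow_distrib)
  then show ?thesis using that unfolding powers_def by blast
qed

lemma glue_local:
  assumes g: "g \<in> carrier T" and h: "h \<in> carrier T"
    and a: "a \<in> carrier T" "s \<in> powers T h" and y: "y \<in> carrier (localization T g)"
    and compat: "loc_res T g (g \<otimes> h) y = loc_res T h (g \<otimes> h) (fraction T h a s)"
  shows "\<exists>N \<in> powers T h. to_loc T g (N \<otimes> s) \<otimes>\<^bsub>localization T g\<^esub> y = to_loc T g (N \<otimes> a)"
proof -
  obtain b t where b: "b \<in> carrier T" "t \<in> powers T g" "y = fraction T g b t"
    using y by (rule localization_carrierE)
  obtain h' where h': "h' \<in> powers T h" "t \<otimes> h' \<in> powers T (g \<otimes> h)"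
    using mult_in_powers_mult[OF g h b(2)] .
  obtain g' where g': "g' \<in> powers T g" "s \<otimes> g' \<in> powers T (h \<otimes> g)"
    using mult_in_powers_mult[OF h g a(2)] .
  have g'2: "s \<otimes> g' \<in> powers T (g \<otimes> h)" using g'(2) m_comm[OF g h] by simp
  have sub: "D (g \<otimes> h) \<subseteq> D g" "D (g \<otimes> h) \<subseteq> D h" using basic_open_mult[OF g h] by auto
  have ghc: "g \<otimes> h \<in> carrier T" using g h by simp
  have cl: "a \<in> carrier T" "b \<in> carrier T" "s \<in> carrier T" "t \<in> carrier T" "h' \<in> carrier T" "g' \<in> carrier T"
    using a b powers_closed[OF g] powers_closed[OF h] h'(1) g'(1) by auto
  have "fraction T (g \<otimes> h) (b \<otimes> h') (t \<otimes> h') = fraction T (g \<otimes> h) (a \<otimes> g') (s \<otimes> g')"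
    using compat unfolding b(3)
    using basic_res_fraction[OF g ghc sub(1) b(1,2) cl(5) h'(2)]
      basic_res_fraction[OF h ghc sub(2) a cl(6) g'2] by simp
  then obtain w where w: "w \<in> powers T (g \<otimes> h)"
    "w \<otimes> (b \<otimes> h') \<otimes> (s \<otimes> g') = w \<otimes> (a \<otimes> g') \<otimes> (t \<otimes> h')"
    using fraction_eq_iff[OF ghc, of "b \<otimes> h'" "a \<otimes> g'" "t \<otimes> h'" "s \<otimes> g'"] cl h'(2) g'2 by auto
  obtain p q where pq: "p \<in> powers T g" "q \<in> powers T h" "w = p \<otimes> q"
    using in_powers_mult[OF g h w(1)] .
  have pc: "p \<in> carrier T" "q \<in> carrier T" using pq powers_closed[OF g] powers_closed[OF h] by auto
  define N where "N = q \<otimes> h'"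
  have N: "N \<in> powers T h" "N \<in> carrier T"
    using pq h' mult_in_powers[OF h] cl pc by (auto simp: N_def)
  have "(p \<otimes> g') \<otimes> (N \<otimes> s \<otimes> b) = w \<otimes> (b \<otimes> h') \<otimes> (s \<otimes> g')"
    unfolding N_def pq(3) using cl pc by (simp add: m_ac)
  also note w(2)
  also have "w \<otimes> (a \<otimes> g') \<otimes> (t \<otimes> h') = (p \<otimes> g') \<otimes> (N \<otimes> a) \<otimes> t"
    unfolding N_def pq(3) using cl pc by (simp add: m_ac)
  finally have e: "(p \<otimes> g') \<otimes> (N \<otimes> s \<otimes> b) \<otimes> \<one> = (p \<otimes> g') \<otimes> (N \<otimes> a) \<otimes> t"
    using cl pc N by simp
  have "to_loc T g (N \<otimes> s) \<otimes>\<^bsub>localization T g\<^esub> y = fraction T g (N \<otimes> s \<otimes> b) t"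
    unfolding b(3) using g cl N b(2) by (simp add: mult_fraction one_in_powers)
  also have "\<dots> = to_loc T g (N \<otimes> a)"
    using e mult_in_powers[OF g pq(1) g'(1)] cl N b(2) one_in_powers
    by (subst fraction_eq_iff[OF g]) auto
  finally show ?thesis using N by blast
qed

lemma to_loc_mult:
  assumes "g \<in> carrier T" "a \<in> carrier T" "b \<in> carrier T"
  shows "to_loc T g (a \<otimes> b) = to_loc T g a \<otimes>\<^bsub>localization T g\<^esub> to_loc T g b"
    and "to_loc T g (a \<oplus> b) = to_loc T g a \<oplus>\<^bsub>localization T g\<^esub> to_loc T g b"
    and "to_loc T g a \<in> carrier (localization T g)"
  using assms by (simp_all add: mult_fraction add_fraction one_in_powers fraction_closed)

lemma loc_gluing:
  assumes f: "f \<in> carrier T" and G: "G \<subseteq> carrier T" and sub: "\<And>g. g \<in> G \<Longrightarrow> D g \<subseteq> D f"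
    and cov: "D f \<subseteq> (\<Union>g \<in> G. D g)"
    and \<sigma>: "\<And>g. g \<in> G \<Longrightarrow> \<sigma> g \<in> carrier (localization T g)"
    and compat: "\<And>g h. g \<in> G \<Longrightarrow> h \<in> G \<Longrightarrow>
      loc_res T g (g \<otimes> h) (\<sigma> g) = loc_res T h (g \<otimes> h) (\<sigma> h)"
  shows "\<exists>x \<in> carrier (localization T f). \<forall>g \<in> G. loc_res T f g x = \<sigma> g"
proof -
  obtain F where F: "finite F" "F \<subseteq> G" and Fcov: "D f \<subseteq> (\<Union>g \<in> F. D g)"
    using finite_subcover[OF f G cov] .
  have Fc: "g \<in> carrier T" if "g \<in> F" for g using F G that by blast
  have F\<sigma>: "\<sigma> g \<in> carrier (localization T g)" if "g \<in> F" for g using F \<sigma> that by blast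
  define J where "J = {d \<in> carrier T. \<exists>b \<in> carrier T. \<forall>g \<in> F.
    to_loc T g d \<otimes>\<^bsub>localization T g\<^esub> \<sigma> g = to_loc T g b}"
  have J: "gamma_ideal \<Gamma> T u J"
    unfolding gamma_ideal_iff
  proof (intro conjI ballI)
    show "J \<subseteq> carrier T" by (auto simp: J_def)
    have "to_loc T g \<zero> \<otimes>\<^bsub>localization T g\<^esub> \<sigma> g = to_loc T g \<zero>" if "g \<in> F" for g
    proof -
      interpret G: comm_semiring "localization T g" using localization_comm_semiring[OF Fc[OF that]] .
      show ?thesis using G.l_null[OF F\<sigma>[OF that]] by (simp add: localization_zero)
    qed
    then show "\<zero> \<in> J" unfolding J_def by blast
    fix d assume "d \<in> J"
    then obtain b where d: "d \<in> carrier T" "b \<in> carrier T"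
      "\<And>g. g \<in> F \<Longrightarrow> to_loc T g d \<otimes>\<^bsub>localization T g\<^esub> \<sigma> g = to_loc T g b" by (auto simp: J_def)
    { fix e assume "e \<in> J"
      then obtain c where e: "e \<in> carrier T" "c \<in> carrier T"
        "\<And>g. g \<in> F \<Longrightarrow> to_loc T g e \<otimes>\<^bsub>localization T g\<^esub> \<sigma> g = to_loc T g c" by (auto simp: J_def)
      have "to_loc T g (d \<oplus> e) \<otimes>\<^bsub>localization T g\<^esub> \<sigma> g = to_loc T g (b \<oplus> c)" if g: "g \<in> F" for g
      proof -
        interpret G: comm_semiring "localization T g" using localization_comm_semiring[OF Fc[OF g]] .
        show ?thesis
          using d e g F\<sigma>[OF g] to_loc_mult[OF Fc[OF g]] by (simp add: G.l_distr)
      qed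
      then show "d \<oplus> e \<in> J" unfolding J_def using d e by blast }
    { fix e assume e: "e \<in> carrier T"
      have "to_loc T g (e \<otimes> d) \<otimes>\<^bsub>localization T g\<^esub> \<sigma> g = to_loc T g (e \<otimes> b)" if g: "g \<in> F" for g
      proof -
        interpret G: comm_semiring "localization T g" using localization_comm_semiring[OF Fc[OF g]] .
        show ?thesis
          using d e g F\<sigma>[OF g] to_loc_mult[OF Fc[OF g]] by (simp add: G.m_assoc)
      qed
      then have "e \<otimes> d \<in> J" unfolding J_def using d e by blast
      then show "d \<otimes> e \<in> J" using m_comm[OF d(1) e] by simp }
  qed
  have meet: "J \<inter> powers T h \<noteq> {}" if h: "h \<in> F" for h
  proof -
    have hc: "h \<in> carrier T" using Fc h .
    obtain a s where a: "a \<in> carrier T" "s \<in> powers T h" "\<sigma> h = fraction T h a s"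
      using F\<sigma>[OF h] by (rule localization_carrierE)
    have sc: "s \<in> carrier T" using powers_closed[OF hc a(2)] .
    have "\<exists>N \<in> powers T h. \<forall>g \<in> F.
      to_loc T g (N \<otimes> s) \<otimes>\<^bsub>localization T g\<^esub> \<sigma> g = to_loc T g (N \<otimes> a)"
    proof (rule uniform_power[OF hc F(1)])
      fix g assume g: "g \<in> F"
      then have "g \<in> G" "h \<in> G" using F h by auto
      then show "\<exists>N \<in> powers T h. to_loc T g (N \<otimes> s) \<otimes>\<^bsub>localization T g\<^esub> \<sigma> g = to_loc T g (N \<otimes> a)"
        using glue_local[OF Fc[OF g] hc a(1,2) F\<sigma>[OF g]] compat[of g h] a(3) by simp
    next
      fix N M g assume N: "N \<in> powers T h" "M \<in> powers T h" and g: "g \<in> F"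
        and e: "to_loc T g (N \<otimes> s) \<otimes>\<^bsub>localization T g\<^esub> \<sigma> g = to_loc T g (N \<otimes> a)"
      have cl: "N \<in> carrier T" "M \<in> carrier T" using N powers_closed[OF hc] by auto
      interpret G: comm_semiring "localization T g" using localization_comm_semiring[OF Fc[OF g]] .
      note tl = to_loc_mult[OF Fc[OF g]]
      have "N \<otimes> M \<otimes> s = M \<otimes> (N \<otimes> s)" "N \<otimes> M \<otimes> a = M \<otimes> (N \<otimes> a)"
        using cl sc a(1) by (simp_all add: m_ac)
      then show "to_loc T g (N \<otimes> M \<otimes> s) \<otimes>\<^bsub>localization T g\<^esub> \<sigma> g = to_loc T g (N \<otimes> M \<otimes> a)"
        using tl(1)[of M "N \<otimes> s"] tl(1)[of M "N \<otimes> a"] tl(3)[of M M] tl(3)[of "N \<otimes> s" M]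
          G.m_assoc[of "to_loc T g M" "to_loc T g (N \<otimes> s)" "\<sigma> g"] e cl sc a(1) F\<sigma>[OF g] by simp
    qed
    then obtain N where N: "N \<in> powers T h"
      "\<forall>g \<in> F. to_loc T g (N \<otimes> s) \<otimes>\<^bsub>localization T g\<^esub> \<sigma> g = to_loc T g (N \<otimes> a)" by blast
    have "N \<in> carrier T" using powers_closed[OF hc N(1)] .
    then have "N \<otimes> s \<in> J" unfolding J_def using N(2) sc a(1) by blast
    then show ?thesis using mult_in_powers[OF hc N(1) a(2)] by blast
  qed
  have "J \<inter> powers T f \<noteq> {}"
  proof
    assume "J \<inter> powers T f = {}"
    then obtain P where P: "P \<in> Spec \<Gamma> T u" "J \<subseteq> P" "f \<notin> P"
      using prime_avoiding_powers[OF J f] by blast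
    then obtain h where h: "h \<in> F" "h \<notin> P" using Fcov by (auto simp: basic_open_def)
    then show False using meet[OF h(1)] powers_notin_prime[OF P(1) Fc[OF h(1)] h(2)] P(2) by blast
  qed
  then obtain d b where d: "d \<in> powers T f" "b \<in> carrier T"
    "\<And>g. g \<in> F \<Longrightarrow> to_loc T g d \<otimes>\<^bsub>localization T g\<^esub> \<sigma> g = to_loc T g b" by (auto simp: J_def)
  have dc: "d \<in> carrier T" using powers_closed[OF f d(1)] .
  define x where "x = fraction T f b d"
  have x: "x \<in> carrier (localization T f)" using d by (simp add: x_def fraction_closed)
  have xF: "loc_res T f g x = \<sigma> g" if g: "g \<in> F" for g
  proof -
    have gG: "g \<in> G" and gc: "g \<in> carrier T" using g F Fc by auto
    obtain c where c: "c \<in> carrier T" "d \<otimes> c \<in> powers T g" using basic_dom[OF f gc sub[OF gG] d(1)] by blast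
    have "to_loc T g d \<otimes>\<^bsub>localization T g\<^esub> loc_res T f g x = to_loc T g b"
    proof -
      have dcc: "d \<otimes> c \<in> carrier T" using dc c by simp
      have "to_loc T g d \<otimes>\<^bsub>localization T g\<^esub> loc_res T f g x = fraction T g (d \<otimes> (b \<otimes> c)) (\<one> \<otimes> (d \<otimes> c))"
        unfolding x_def basic_res_fraction[OF f gc sub[OF gG] d(2,1) c]
        by (rule mult_fraction) (use gc dc d(2) c one_in_powers in auto)
      also have "\<dots> = to_loc T g b"
        by (rule fraction_eqI) (use gc dc dcc d(2) c one_in_powers in \<open>auto simp: m_lcomm\<close>)
      finally show ?thesis .
    qed
    then show ?thesis
      using to_loc_cancel[OF gc dc c basic_res_closed[OF f gc sub[OF gG] x] F\<sigma>[OF g]] d(3)[OF g] by simp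
  qed
  have "loc_res T f g x = \<sigma> g" if g: "g \<in> G" for g
  proof -
    have gc: "g \<in> carrier T" using g G by blast
    show ?thesis
    proof (rule loc_locality[OF gc, of "(\<lambda>h. g \<otimes> h) ` F"])
      show "(\<lambda>h. g \<otimes> h) ` F \<subseteq> carrier T" using gc Fc by auto
      show "D k \<subseteq> D g" if "k \<in> (\<lambda>h. g \<otimes> h) ` F" for k
        using that basic_open_mult[OF gc Fc] by auto
      show "D g \<subseteq> (\<Union>k \<in> (\<lambda>h. g \<otimes> h) ` F. D k)"
        using basic_open_mult[OF gc Fc] sub[OF g] Fcov by auto
      show "loc_res T f g x \<in> carrier (localization T g)" using basic_res_closed[OF f gc sub[OF g] x] .
      show "\<sigma> g \<in> carrier (localization T g)" using \<sigma>[OF g] .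
      fix k assume "k \<in> (\<lambda>h. g \<otimes> h) ` F"
      then obtain h where h: "h \<in> F" and ke: "k = g \<otimes> h" by blast
      have hc: "h \<in> carrier T" and hG: "h \<in> G" using h Fc F by auto
      have kc: "k \<in> carrier T" and kg: "D k \<subseteq> D g" and kh: "D k \<subseteq> D h"
        unfolding ke using gc hc basic_open_mult[OF gc hc] by auto
      have "loc_res T g k (loc_res T f g x) = loc_res T f k x"
        using basic_res_trans[OF f gc kc sub[OF g] kg x] .
      also have "\<dots> = loc_res T h k (loc_res T f h x)"
        using basic_res_trans[OF f hc kc sub[OF hG] kh x] by simp
      also have "\<dots> = loc_res T g k (\<sigma> g)" using xF[OF h] compat[OF g hG] ke by simp
      finally show "loc_res T g k (loc_res T f g x) = loc_res T g k (\<sigma> g)" .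
    qed
  qed
  then show ?thesis using x by blast
qed

abbreviation (input) B where "B \<equiv> basic_opens_in \<Gamma> T u"
abbreviation (input) \<O> where "\<O> \<equiv> structure_sheaf \<Gamma> T u"

lemma in_sections:
  "s \<in> carrier (\<O> U) \<longleftrightarrow> s \<in> extensional (B U) \<and> (\<forall>f \<in> B U. s f \<in> carrier (localization T f)) \<and>
    (\<forall>f \<in> B U. \<forall>g \<in> carrier T. D g \<subseteq> D f \<longrightarrow> loc_res T f g (s f) = s g)"
  by (auto simp: structure_sheaf_def PiE_def Pi_def)

lemma sections_simps:
  "s \<otimes>\<^bsub>\<O> U\<^esub> t = (\<lambda>f \<in> B U. s f \<otimes>\<^bsub>localization T f\<^esub> t f)"
  "s \<oplus>\<^bsub>\<O> U\<^esub> t = (\<lambda>f \<in> B U. s f \<oplus>\<^bsub>localization T f\<^esub> t f)"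
  "\<one>\<^bsub>\<O> U\<^esub> = (\<lambda>f \<in> B U. \<one>\<^bsub>localization T f\<^esub>)"
  "\<zero>\<^bsub>\<O> U\<^esub> = (\<lambda>f \<in> B U. \<zero>\<^bsub>localization T f\<^esub>)"
  by (simp_all add: structure_sheaf_def)

lemma B_carrier: "f \<in> B U \<Longrightarrow> f \<in> carrier T"
  by (simp add: basic_opens_in_def)

lemma B_sub: "f \<in> B U \<Longrightarrow> g \<in> carrier T \<Longrightarrow> D g \<subseteq> D f \<Longrightarrow> g \<in> B U"
  by (auto simp: basic_opens_in_def)

lemma B_mono: "W \<subseteq> U \<Longrightarrow> B W \<subseteq> B U"
  by (auto simp: basic_opens_in_def)

lemma B_semiring: "f \<in> B U \<Longrightarrow> comm_semiring (localization T f)"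
  using localization_comm_semiring B_carrier by blast

lemma B_res_hom:
  assumes "f \<in> B U" "g \<in> carrier T" "D g \<subseteq> D f"
  shows "loc_res T f g \<in> ring_hom (localization T f) (localization T g)"
    "loc_res T f g \<zero>\<^bsub>localization T f\<^esub> = \<zero>\<^bsub>localization T g\<^esub>"
  using basic_res_hom[OF B_carrier[OF assms(1)] assms(2,3)] by (auto simp: semiring_hom_def)

lemma sections_closed:
  assumes s: "s \<in> carrier (\<O> U)" and t: "t \<in> carrier (\<O> U)"
  shows "s \<otimes>\<^bsub>\<O> U\<^esub> t \<in> carrier (\<O> U)" "s \<oplus>\<^bsub>\<O> U\<^esub> t \<in> carrier (\<O> U)"
proof -
  have cl: "s f \<in> carrier (localization T f)" "t f \<in> carrier (localization T f)" if "f \<in> B U" for f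
    using s t that by (auto simp: in_sections)
  have m: "s f \<otimes>\<^bsub>localization T f\<^esub> t f \<in> carrier (localization T f)"
    "s f \<oplus>\<^bsub>localization T f\<^esub> t f \<in> carrier (localization T f)" if f: "f \<in> B U" for f
  proof -
    interpret F: comm_semiring "localization T f" using B_semiring[OF f] .
    show "s f \<otimes>\<^bsub>localization T f\<^esub> t f \<in> carrier (localization T f)"
      "s f \<oplus>\<^bsub>localization T f\<^esub> t f \<in> carrier (localization T f)" using cl[OF f] by auto
  qed
  have r: "loc_res T f g (s f \<otimes>\<^bsub>localization T f\<^esub> t f) = s g \<otimes>\<^bsub>localization T g\<^esub> t g"
    "loc_res T f g (s f \<oplus>\<^bsub>localization T f\<^esub> t f) = s g \<oplus>\<^bsub>localization T g\<^esub> t g"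
    if f: "f \<in> B U" "g \<in> carrier T" "D g \<subseteq> D f" for f g
    using ring_hom_mult[OF B_res_hom(1)[OF f] cl[OF f(1)]] ring_hom_add[OF B_res_hom(1)[OF f] cl[OF f(1)]]
      s t f by (simp_all add: in_sections)
  show "s \<otimes>\<^bsub>\<O> U\<^esub> t \<in> carrier (\<O> U)" "s \<oplus>\<^bsub>\<O> U\<^esub> t \<in> carrier (\<O> U)"
    using m r B_sub by (simp_all add: in_sections sections_simps)
qed

lemma to_section_closed: "a \<in> carrier T \<Longrightarrow> to_section \<Gamma> T u U a \<in> carrier (\<O> U)"
proof -
  assume a: "a \<in> carrier T"
  have "loc_res T f g (to_loc T f a) = to_loc T g a" if "f \<in> B U" "g \<in> carrier T" "D g \<subseteq> D f" for f g
    using basic_res_to_loc[OF B_carrier[OF that(1)] that(2,3) a] .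
  moreover have "g \<in> B U" if "f \<in> B U" "g \<in> carrier T" "D g \<subseteq> D f" for f g
    using B_sub[OF that] .
  ultimately show ?thesis
    unfolding in_sections to_section_def using a by (simp add: fraction_closed one_in_powers)
qed

lemma sections_const: "\<one>\<^bsub>\<O> U\<^esub> = to_section \<Gamma> T u U \<one>" "\<zero>\<^bsub>\<O> U\<^esub> = to_section \<Gamma> T u U \<zero>"
  by (simp_all add: sections_simps to_section_def localization_one localization_zero)

lemma sections_comm_semiring: "comm_semiring (\<O> U)"
proof -
  have el: "s f \<in> carrier (localization T f)" if "s \<in> carrier (\<O> U)" "f \<in> B U" for s f
    using that by (simp add: in_sections)
  have ext0: "(\<lambda>f \<in> B U. s f) = s" if "s \<in> carrier (\<O> U)" for s
    using that by (simp add: in_sections extensional_restrict)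
  have cst: "\<one>\<^bsub>\<O> U\<^esub> \<in> carrier (\<O> U)" "\<zero>\<^bsub>\<O> U\<^esub> \<in> carrier (\<O> U)"
    unfolding sections_const by (simp_all add: to_section_closed)
  have s1: "(s \<oplus>\<^bsub>\<O> U\<^esub> t) \<oplus>\<^bsub>\<O> U\<^esub> r = s \<oplus>\<^bsub>\<O> U\<^esub> (t \<oplus>\<^bsub>\<O> U\<^esub> r)"
    "(s \<otimes>\<^bsub>\<O> U\<^esub> t) \<otimes>\<^bsub>\<O> U\<^esub> r = s \<otimes>\<^bsub>\<O> U\<^esub> (t \<otimes>\<^bsub>\<O> U\<^esub> r)"
    "s \<oplus>\<^bsub>\<O> U\<^esub> t = t \<oplus>\<^bsub>\<O> U\<^esub> s" "s \<otimes>\<^bsub>\<O> U\<^esub> t = t \<otimes>\<^bsub>\<O> U\<^esub> s"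
    "(s \<oplus>\<^bsub>\<O> U\<^esub> t) \<otimes>\<^bsub>\<O> U\<^esub> r = s \<otimes>\<^bsub>\<O> U\<^esub> r \<oplus>\<^bsub>\<O> U\<^esub> t \<otimes>\<^bsub>\<O> U\<^esub> r"
    "r \<otimes>\<^bsub>\<O> U\<^esub> (s \<oplus>\<^bsub>\<O> U\<^esub> t) = r \<otimes>\<^bsub>\<O> U\<^esub> s \<oplus>\<^bsub>\<O> U\<^esub> r \<otimes>\<^bsub>\<O> U\<^esub> t"
    if str: "s \<in> carrier (\<O> U)" "t \<in> carrier (\<O> U)" "r \<in> carrier (\<O> U)" for s t r
  proof -
    have pt: "s f \<oplus>\<^bsub>localization T f\<^esub> t f \<oplus>\<^bsub>localization T f\<^esub> r f =
        s f \<oplus>\<^bsub>localization T f\<^esub> (t f \<oplus>\<^bsub>localization T f\<^esub> r f)"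
      "s f \<otimes>\<^bsub>localization T f\<^esub> t f \<otimes>\<^bsub>localization T f\<^esub> r f =
        s f \<otimes>\<^bsub>localization T f\<^esub> (t f \<otimes>\<^bsub>localization T f\<^esub> r f)"
      "s f \<oplus>\<^bsub>localization T f\<^esub> t f = t f \<oplus>\<^bsub>localization T f\<^esub> s f"
      "s f \<otimes>\<^bsub>localization T f\<^esub> t f = t f \<otimes>\<^bsub>localization T f\<^esub> s f"
      "(s f \<oplus>\<^bsub>localization T f\<^esub> t f) \<otimes>\<^bsub>localization T f\<^esub> r f =
        s f \<otimes>\<^bsub>localization T f\<^esub> r f \<oplus>\<^bsub>localization T f\<^esub> t f \<otimes>\<^bsub>localization T f\<^esub> r f"
      "r f \<otimes>\<^bsub>localization T f\<^esub> (s f \<oplus>\<^bsub>localization T f\<^esub> t f) =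
        r f \<otimes>\<^bsub>localization T f\<^esub> s f \<oplus>\<^bsub>localization T f\<^esub> r f \<otimes>\<^bsub>localization T f\<^esub> t f"
      if f: "f \<in> B U" for f
    proof -
      interpret F: comm_semiring "localization T f" using B_semiring[OF f] .
      note e = el[OF str(1) f] el[OF str(2) f] el[OF str(3) f]
      show "s f \<oplus>\<^bsub>localization T f\<^esub> t f \<oplus>\<^bsub>localization T f\<^esub> r f =
          s f \<oplus>\<^bsub>localization T f\<^esub> (t f \<oplus>\<^bsub>localization T f\<^esub> r f)" by (rule F.a_assoc[OF e])
      show "s f \<otimes>\<^bsub>localization T f\<^esub> t f \<otimes>\<^bsub>localization T f\<^esub> r f =
          s f \<otimes>\<^bsub>localization T f\<^esub> (t f \<otimes>\<^bsub>localization T f\<^esub> r f)" by (rule F.m_assoc[OF e])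
      show "s f \<oplus>\<^bsub>localization T f\<^esub> t f = t f \<oplus>\<^bsub>localization T f\<^esub> s f"
        by (rule F.a_comm[OF e(1,2)])
      show "s f \<otimes>\<^bsub>localization T f\<^esub> t f = t f \<otimes>\<^bsub>localization T f\<^esub> s f"
        by (rule F.m_comm[OF e(1,2)])
      show "(s f \<oplus>\<^bsub>localization T f\<^esub> t f) \<otimes>\<^bsub>localization T f\<^esub> r f =
          s f \<otimes>\<^bsub>localization T f\<^esub> r f \<oplus>\<^bsub>localization T f\<^esub> t f \<otimes>\<^bsub>localization T f\<^esub> r f"
        by (rule F.l_distr[OF e])
      show "r f \<otimes>\<^bsub>localization T f\<^esub> (s f \<oplus>\<^bsub>localization T f\<^esub> t f) =
          r f \<otimes>\<^bsub>localization T f\<^esub> s f \<oplus>\<^bsub>localization T f\<^esub> r f \<otimes>\<^bsub>localization T f\<^esub> t f"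
        by (rule F.r_distr[OF e])
    qed
    show "(s \<oplus>\<^bsub>\<O> U\<^esub> t) \<oplus>\<^bsub>\<O> U\<^esub> r = s \<oplus>\<^bsub>\<O> U\<^esub> (t \<oplus>\<^bsub>\<O> U\<^esub> r)"
      unfolding sections_simps by (rule restrict_ext) (simp add: pt(1))
    show "(s \<otimes>\<^bsub>\<O> U\<^esub> t) \<otimes>\<^bsub>\<O> U\<^esub> r = s \<otimes>\<^bsub>\<O> U\<^esub> (t \<otimes>\<^bsub>\<O> U\<^esub> r)"
      unfolding sections_simps by (rule restrict_ext) (simp add: pt(2))
    show "s \<oplus>\<^bsub>\<O> U\<^esub> t = t \<oplus>\<^bsub>\<O> U\<^esub> s"
      unfolding sections_simps by (rule restrict_ext) (rule pt(3))
    show "s \<otimes>\<^bsub>\<O> U\<^esub> t = t \<otimes>\<^bsub>\<O> U\<^esub> s"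
      unfolding sections_simps by (rule restrict_ext) (rule pt(4))
    show "(s \<oplus>\<^bsub>\<O> U\<^esub> t) \<otimes>\<^bsub>\<O> U\<^esub> r = s \<otimes>\<^bsub>\<O> U\<^esub> r \<oplus>\<^bsub>\<O> U\<^esub> t \<otimes>\<^bsub>\<O> U\<^esub> r"
      unfolding sections_simps by (rule restrict_ext) (simp add: pt(5))
    show "r \<otimes>\<^bsub>\<O> U\<^esub> (s \<oplus>\<^bsub>\<O> U\<^esub> t) = r \<otimes>\<^bsub>\<O> U\<^esub> s \<oplus>\<^bsub>\<O> U\<^esub> r \<otimes>\<^bsub>\<O> U\<^esub> t"
      unfolding sections_simps by (rule restrict_ext) (simp add: pt(6))
  qed
  have s2: "\<zero>\<^bsub>\<O> U\<^esub> \<oplus>\<^bsub>\<O> U\<^esub> s = s" "\<one>\<^bsub>\<O> U\<^esub> \<otimes>\<^bsub>\<O> U\<^esub> s = s"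
    "\<zero>\<^bsub>\<O> U\<^esub> \<otimes>\<^bsub>\<O> U\<^esub> s = \<zero>\<^bsub>\<O> U\<^esub>" "s \<otimes>\<^bsub>\<O> U\<^esub> \<zero>\<^bsub>\<O> U\<^esub> = \<zero>\<^bsub>\<O> U\<^esub>"
    if s: "s \<in> carrier (\<O> U)" for s
  proof -
    have pt: "\<zero>\<^bsub>localization T f\<^esub> \<oplus>\<^bsub>localization T f\<^esub> s f = s f"
      "\<one>\<^bsub>localization T f\<^esub> \<otimes>\<^bsub>localization T f\<^esub> s f = s f"
      "\<zero>\<^bsub>localization T f\<^esub> \<otimes>\<^bsub>localization T f\<^esub> s f = \<zero>\<^bsub>localization T f\<^esub>"
      "s f \<otimes>\<^bsub>localization T f\<^esub> \<zero>\<^bsub>localization T f\<^esub> = \<zero>\<^bsub>localization T f\<^esub>"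
      if f: "f \<in> B U" for f
    proof -
      interpret F: comm_semiring "localization T f" using B_semiring[OF f] .
      show "\<zero>\<^bsub>localization T f\<^esub> \<oplus>\<^bsub>localization T f\<^esub> s f = s f"
        "\<one>\<^bsub>localization T f\<^esub> \<otimes>\<^bsub>localization T f\<^esub> s f = s f"
        "\<zero>\<^bsub>localization T f\<^esub> \<otimes>\<^bsub>localization T f\<^esub> s f = \<zero>\<^bsub>localization T f\<^esub>"
        "s f \<otimes>\<^bsub>localization T f\<^esub> \<zero>\<^bsub>localization T f\<^esub> = \<zero>\<^bsub>localization T f\<^esub>"
        using el[OF s f] by simp_all
    qed
    have "(\<lambda>f \<in> B U. \<zero>\<^bsub>localization T f\<^esub> \<oplus>\<^bsub>localization T f\<^esub> s f) = s"
      "(\<lambda>f \<in> B U. \<one>\<^bsub>localization T f\<^esub> \<otimes>\<^bsub>localization T f\<^esub> s f) = s"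
      using pt ext0[OF s] by (metis (mono_tags, lifting) restrict_ext)+
    then show "\<zero>\<^bsub>\<O> U\<^esub> \<oplus>\<^bsub>\<O> U\<^esub> s = s" "\<one>\<^bsub>\<O> U\<^esub> \<otimes>\<^bsub>\<O> U\<^esub> s = s"
      unfolding sections_simps by (simp_all cong: restrict_cong)
    show "\<zero>\<^bsub>\<O> U\<^esub> \<otimes>\<^bsub>\<O> U\<^esub> s = \<zero>\<^bsub>\<O> U\<^esub>" "s \<otimes>\<^bsub>\<O> U\<^esub> \<zero>\<^bsub>\<O> U\<^esub> = \<zero>\<^bsub>\<O> U\<^esub>"
      unfolding sections_simps by (rule restrict_ext; simp add: pt)+
  qed
  have am: "abelian_monoid (\<O> U)"
    by (rule abelian_monoidI) (assumption | rule s1(1,3) s2(1) cst sections_closed)+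
  have cm: "comm_monoid (\<O> U)"
    by (rule comm_monoidI) (assumption | rule s1(2,4) s2(2) cst sections_closed)+
  show ?thesis
    by (intro comm_semiring.intro semiring.intro semiring_axioms.intro am cm comm_monoid.axioms(1)[OF cm])
      (assumption | rule s1(5,6) s2(3,4))+
qed

lemma res_hom:
  assumes WU: "W \<subseteq> U"
  shows "(\<lambda>\<sigma>. restrict \<sigma> (B W)) \<in> semiring_hom (\<O> U) (\<O> W)"
proof -
  have sub: "B W \<subseteq> B U" using B_mono[OF WU] .
  have "(\<lambda>\<sigma>. restrict \<sigma> (B W)) \<in> ring_hom (\<O> U) (\<O> W)"
  proof (rule ring_hom_memI)
    fix s assume s: "s \<in> carrier (\<O> U)"
    show "restrict s (B W) \<in> carrier (\<O> W)"
      using s sub B_sub by (auto simp: in_sections)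
  next
    fix s t
    show "restrict (s \<otimes>\<^bsub>\<O> U\<^esub> t) (B W) = restrict s (B W) \<otimes>\<^bsub>\<O> W\<^esub> restrict t (B W)"
      unfolding sections_simps using sub by (intro ext) (simp add: restrict_def subset_iff)
    show "restrict (s \<oplus>\<^bsub>\<O> U\<^esub> t) (B W) = restrict s (B W) \<oplus>\<^bsub>\<O> W\<^esub> restrict t (B W)"
      unfolding sections_simps using sub by (intro ext) (simp add: restrict_def subset_iff)
  next
    show "restrict \<one>\<^bsub>\<O> U\<^esub> (B W) = \<one>\<^bsub>\<O> W\<^esub>"
      unfolding sections_simps using sub by (intro ext) (simp add: restrict_def subset_iff)
  qed
  moreover have "restrict \<zero>\<^bsub>\<O> U\<^esub> (B W) = \<zero>\<^bsub>\<O> W\<^esub>"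
    unfolding sections_simps using sub by (intro ext) (simp add: restrict_def subset_iff)
  ultimately show ?thesis by (simp add: semiring_hom_def)
qed

lemma cover_by_basic:
  assumes op: "\<And>U. U \<in> \<U> \<Longrightarrow> openin (spec_topology \<Gamma> T u) U" and f: "f \<in> B (\<Union>\<U>)"
  shows "D f \<subseteq> (\<Union>g \<in> {g \<in> carrier T. D g \<subseteq> D f \<and> (\<exists>U \<in> \<U>. D g \<subseteq> U)}. D g)"
proof
  fix P assume P: "P \<in> D f"
  then obtain U where U: "U \<in> \<U>" "P \<in> U" using f by (auto simp: basic_opens_in_def)
  obtain k where k: "k \<in> carrier T" "P \<in> D k" "D k \<subseteq> U" using openin_basic[OF op[OF U(1)] U(2)] .
  have fc: "f \<in> carrier T" using B_carrier[OF f] .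
  have "f \<otimes> k \<in> carrier T" "P \<in> D (f \<otimes> k)" "D (f \<otimes> k) \<subseteq> D f" "D (f \<otimes> k) \<subseteq> U"
    using basic_open_mult[OF fc k(1)] P k fc by auto
  then show "P \<in> (\<Union>g \<in> {g \<in> carrier T. D g \<subseteq> D f \<and> (\<exists>U \<in> \<U>. D g \<subseteq> U)}. D g)"
    using U(1) by blast
qed

lemma sheaf_locality:
  assumes op: "\<And>U. U \<in> \<U> \<Longrightarrow> openin (spec_topology \<Gamma> T u) U"
    and s: "s \<in> carrier (\<O> (\<Union>\<U>))" and t: "t \<in> carrier (\<O> (\<Union>\<U>))"
    and eq: "\<And>U. U \<in> \<U> \<Longrightarrow> restrict s (B U) = restrict t (B U)"
  shows "s = t"
proof (rule extensionalityI[of _ "B (\<Union>\<U>)"])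
  show "s \<in> extensional (B (\<Union>\<U>))" "t \<in> extensional (B (\<Union>\<U>))" using s t by (auto simp: in_sections)
  fix f assume f: "f \<in> B (\<Union>\<U>)"
  show "s f = t f"
  proof (rule loc_locality[OF B_carrier[OF f] _ _ cover_by_basic[OF op f]])
    show "s f \<in> carrier (localization T f)" "t f \<in> carrier (localization T f)"
      using s t f by (auto simp: in_sections)
    fix g assume "g \<in> {g \<in> carrier T. D g \<subseteq> D f \<and> (\<exists>U \<in> \<U>. D g \<subseteq> U)}"
    then obtain U where g: "g \<in> carrier T" "D g \<subseteq> D f" "U \<in> \<U>" "D g \<subseteq> U" by blast
    then have "g \<in> B U" by (simp add: basic_opens_in_def)
    then have "s g = t g" using eq[OF g(3)] by (metis restrict_apply')
    then show "loc_res T f g (s f) = loc_res T f g (t f)" using s t f g by (simp add: in_sections)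
  qed auto
qed

lemma sheaf_gluing:
  assumes op: "\<And>U. U \<in> \<U> \<Longrightarrow> openin (spec_topology \<Gamma> T u) U"
    and \<sigma>: "\<And>U. U \<in> \<U> \<Longrightarrow> \<sigma> U \<in> carrier (\<O> U)"
    and compat: "\<And>U W. U \<in> \<U> \<Longrightarrow> W \<in> \<U> \<Longrightarrow>
      restrict (\<sigma> U) (B (U \<inter> W)) = restrict (\<sigma> W) (B (U \<inter> W))"
  shows "\<exists>s \<in> carrier (\<O> (\<Union>\<U>)). \<forall>U \<in> \<U>. restrict s (B U) = \<sigma> U"
proof -
  define \<tau> where "\<tau> g = \<sigma> (SOME U. U \<in> \<U> \<and> D g \<subseteq> U) g" for g
  have \<tau>: "\<tau> g = \<sigma> U g" if g: "g \<in> carrier T" "U \<in> \<U>" "D g \<subseteq> U" for g U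
  proof -
    define W where "W = (SOME U. U \<in> \<U> \<and> D g \<subseteq> U)"
    have W: "W \<in> \<U> \<and> D g \<subseteq> W" unfolding W_def by (rule someI[where P = "\<lambda>U. U \<in> \<U> \<and> D g \<subseteq> U" and x = U]) (use g in simp)
    then have "g \<in> B (W \<inter> U)" using g by (simp add: basic_opens_in_def)
    then have "\<sigma> W g = \<sigma> U g" using compat[of W U] W g by (metis restrict_apply')
    then show ?thesis by (simp add: \<tau>_def W_def)
  qed
  define G where "G f = {g \<in> carrier T. D g \<subseteq> D f \<and> (\<exists>U \<in> \<U>. D g \<subseteq> U)}" for f
  have \<tau>cl: "\<tau> g \<in> carrier (localization T g)" if gG: "g \<in> G f" for g f
  proof -
    obtain U where U: "g \<in> carrier T" "U \<in> \<U>" "D g \<subseteq> U" using gG unfolding G_def by blast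
    then show ?thesis using \<sigma>[OF U(2)] \<tau>[OF U] by (simp add: in_sections basic_opens_in_def)
  qed
  have \<tau>res: "loc_res T g h (\<tau> g) = \<tau> h"
    if gG: "g \<in> G f" and h: "h \<in> carrier T" "D h \<subseteq> D g" for f g h
  proof -
    obtain U where U: "g \<in> carrier T" "U \<in> \<U>" "D g \<subseteq> U" using gG unfolding G_def by blast
    have "D h \<subseteq> U" using h U by blast
    moreover have "g \<in> B U" using U by (simp add: basic_opens_in_def)
    ultimately show ?thesis using \<sigma>[OF U(2)] \<tau>[OF U] \<tau>[OF h(1) U(2)] h by (simp add: in_sections)
  qed
  have ex: "\<exists>x \<in> carrier (localization T f). \<forall>g \<in> G f. loc_res T f g x = \<tau> g" if f: "f \<in> B (\<Union>\<U>)" for f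
  proof (rule loc_gluing[OF B_carrier[OF f]])
    show "G f \<subseteq> carrier T" by (auto simp: G_def)
    show "D g \<subseteq> D f" if "g \<in> G f" for g using that by (simp add: G_def)
    show "D f \<subseteq> (\<Union>g \<in> G f. D g)" unfolding G_def by (rule cover_by_basic[OF op f])
    show "\<tau> g \<in> carrier (localization T g)" if "g \<in> G f" for g using \<tau>cl[OF that] .
    fix g h assume gh: "g \<in> G f" "h \<in> G f"
    have c: "g \<in> carrier T" "h \<in> carrier T" using gh by (auto simp: G_def)
    have "g \<otimes> h \<in> carrier T" "D (g \<otimes> h) \<subseteq> D g" "D (g \<otimes> h) \<subseteq> D h"
      using basic_open_mult[OF c] c by auto
    then show "loc_res T g (g \<otimes> h) (\<tau> g) = loc_res T h (g \<otimes> h) (\<tau> h)"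
      using \<tau>res[OF gh(1)] \<tau>res[OF gh(2)] by simp
  qed
  define s where "s = (\<lambda>f \<in> B (\<Union>\<U>). SOME x. x \<in> carrier (localization T f) \<and> (\<forall>g \<in> G f. loc_res T f g x = \<tau> g))"
  have s: "s f \<in> carrier (localization T f)" "\<And>g. g \<in> G f \<Longrightarrow> loc_res T f g (s f) = \<tau> g"
    if f: "f \<in> B (\<Union>\<U>)" for f
  proof -
    have "\<exists>x. x \<in> carrier (localization T f) \<and> (\<forall>g \<in> G f. loc_res T f g x = \<tau> g)" using ex[OF f] by blast
    from someI_ex[OF this] show "s f \<in> carrier (localization T f)"
      "\<And>g. g \<in> G f \<Longrightarrow> loc_res T f g (s f) = \<tau> g" using f by (simp_all add: s_def)
  qed
  have sres: "loc_res T f h (s f) = s h" if f: "f \<in> B (\<Union>\<U>)" and h: "h \<in> carrier T" "D h \<subseteq> D f" for f h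
  proof -
    have hB: "h \<in> B (\<Union>\<U>)" using B_sub[OF f h] .
    have fc: "f \<in> carrier T" using B_carrier[OF f] .
    show ?thesis
    proof (rule loc_locality[OF h(1) _ _ cover_by_basic[OF op hB]])
      show "loc_res T f h (s f) \<in> carrier (localization T h)" using basic_res_closed[OF fc h s(1)[OF f]] .
      show "s h \<in> carrier (localization T h)" using s(1)[OF hB] .
      fix g assume "g \<in> {g \<in> carrier T. D g \<subseteq> D h \<and> (\<exists>U \<in> \<U>. D g \<subseteq> U)}"
      then have g: "g \<in> carrier T" "D g \<subseteq> D h" "g \<in> G h" "g \<in> G f" using h unfolding G_def by auto
      have "loc_res T h g (loc_res T f h (s f)) = loc_res T f g (s f)"
        using basic_res_trans[OF fc h(1) g(1) h(2) g(2) s(1)[OF f]] .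
      also have "\<dots> = loc_res T h g (s h)" using s(2)[OF f g(4)] s(2)[OF hB g(3)] by simp
      finally show "loc_res T h g (loc_res T f h (s f)) = loc_res T h g (s h)" .
    qed auto
  qed
  have "s \<in> carrier (\<O> (\<Union>\<U>))"
    unfolding in_sections using s(1) sres by (simp add: s_def)
  moreover have "restrict s (B U) = \<sigma> U" if U: "U \<in> \<U>" for U
  proof (rule extensionalityI[of _ "B U"])
    show "\<sigma> U \<in> extensional (B U)" using \<sigma>[OF U] by (simp add: in_sections)
    fix f assume f: "f \<in> B U"
    have fU: "f \<in> B (\<Union>\<U>)" using f U B_mono[of U "\<Union>\<U>"] by blast
    have fc: "f \<in> carrier T" "D f \<subseteq> U" using f by (auto simp: basic_opens_in_def)
    have "f \<in> G f" unfolding G_def using fc U by blast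
    then have "s f = \<tau> f" using s(2)[OF fU] basic_res_id[OF fc(1) s(1)[OF fU]] by simp
    then show "restrict s (B U) f = \<sigma> U f" using f \<tau>[OF fc(1) U fc(2)] by simp
  qed simp
  ultimately show ?thesis by blast
qed

theorem affine_semiringed_space: "semiringed_space (affine_gamma_scheme \<Gamma> T u)"
proof -
  have r: "restrict (restrict s (B W)) (B Z) = restrict s (B Z)" if "Z \<subseteq> W" for s :: "'a \<Rightarrow> ('a \<times> 'a) set" and W Z
    using B_mono[OF that] by (simp add: Int_absorb1)
  have i: "restrict s (B U) = s" if "s \<in> carrier (\<O> U)" for s U
    using that by (simp add: in_sections extensional_restrict)
  show ?thesis
    unfolding semiringed_space_def affine_gamma_scheme_def gamma_space.simps
    by (intro conjI allI impI ballI sections_comm_semiring res_hom i r sheaf_gluing)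
      (use sheaf_locality in blast)+
qed

theorem sections_over_basic_open:
  assumes f: "f \<in> carrier T"
  shows "(\<lambda>\<sigma>. \<sigma> f) \<in> semiring_hom (\<O> (D f)) (localization T f)"
    and "bij_betw (\<lambda>\<sigma>. \<sigma> f) (carrier (\<O> (D f))) (carrier (localization T f))"
    and "a \<in> carrier T \<Longrightarrow> to_section \<Gamma> T u (D f) a f = to_loc T f a"
    and "g \<in> carrier T \<Longrightarrow> D g \<subseteq> D f \<Longrightarrow> \<sigma> \<in> carrier (\<O> (D f)) \<Longrightarrow>
      restrict \<sigma> (B (D g)) g = loc_res T f g (\<sigma> f)"
proof -
  have fB: "f \<in> B (D f)" using f by (simp add: basic_opens_in_def)
  show "(\<lambda>\<sigma>. \<sigma> f) \<in> semiring_hom (\<O> (D f)) (localization T f)"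
    unfolding semiring_hom_def ring_hom_def using fB by (auto simp: sections_simps in_sections)
  show "bij_betw (\<lambda>\<sigma>. \<sigma> f) (carrier (\<O> (D f))) (carrier (localization T f))"
  proof (rule bij_betwI[where g = "\<lambda>x. \<lambda>g \<in> B (D f). loc_res T f g x"])
    show "(\<lambda>\<sigma>. \<sigma> f) \<in> carrier (\<O> (D f)) \<rightarrow> carrier (localization T f)"
      using fB by (auto simp: in_sections)
    show "(\<lambda>x. \<lambda>g \<in> B (D f). loc_res T f g x) \<in> carrier (localization T f) \<rightarrow> carrier (\<O> (D f))"
    proof
      fix x assume x: "x \<in> carrier (localization T f)"
      have "loc_res T f g x \<in> carrier (localization T g)" if "g \<in> B (D f)" for g
        using basic_res_closed[OF f _ _ x] that by (simp add: basic_opens_in_def)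
      moreover have "loc_res T g h (loc_res T f g x) = loc_res T f h x"
        if "g \<in> B (D f)" "h \<in> carrier T" "D h \<subseteq> D g" for g h
        using basic_res_trans[OF f _ _ _ _ x] that by (simp add: basic_opens_in_def)
      ultimately show "(\<lambda>g \<in> B (D f). loc_res T f g x) \<in> carrier (\<O> (D f))"
        using B_sub by (simp add: in_sections)
    qed
    show "(\<lambda>g \<in> B (D f). loc_res T f g x) f = x" if "x \<in> carrier (localization T f)" for x
      using fB basic_res_id[OF f that] by simp
    show "(\<lambda>g \<in> B (D f). loc_res T f g (\<sigma> f)) = \<sigma>" if \<sigma>: "\<sigma> \<in> carrier (\<O> (D f))" for \<sigma>
    proof (rule extensionalityI[of _ "B (D f)"])
      show "\<sigma> \<in> extensional (B (D f))" using \<sigma> by (simp add: in_sections)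
      fix g assume g: "g \<in> B (D f)"
      then show "(\<lambda>g \<in> B (D f). loc_res T f g (\<sigma> f)) g = \<sigma> g"
        using \<sigma> fB by (simp add: in_sections basic_opens_in_def)
    qed simp
  qed
  show "a \<in> carrier T \<Longrightarrow> to_section \<Gamma> T u (D f) a f = to_loc T f a"
    using fB by (simp add: to_section_def)
  show "g \<in> carrier T \<Longrightarrow> D g \<subseteq> D f \<Longrightarrow> \<sigma> \<in> carrier (\<O> (D f)) \<Longrightarrow>
      restrict \<sigma> (B (D g)) g = loc_res T f g (\<sigma> f)"
    using fB by (simp add: in_sections) (simp add: basic_opens_in_def)
qed

end

end

theory Submission
  imports Defs
begin

text \<open>The specialization order of a spectrum can be read off from its topology alone: a prime \<open>P\<close> is
  contained in a prime \<open>Q\<close> exactly when every open set containing \<open>Q\<close> contains \<open>P\<close>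
  (\<open>specialization_iff_open\<close>). An isomorphism of affine \<open>\<Gamma>\<close>-schemes is in particular a
  homeomorphism of spectra, so it preserves and reflects inclusion of primes and hence the edges of
  the specialization graph.

  The second half holds for any isomorphism of graphs: relative to vertex orderings it is a
  permutation \<open>p\<close> of the indices, degrees and adjacency agree along \<open>p\<close>, and hence the
  \<open>(i, j)\<close> entry of one Laplacian is the \<open>(p i, p j)\<close> entry of the other, which is
  conjugation by the permutation matrix of \<open>p\<close>.\<close>

section \<open>Specialization and homeomorphisms of spectra\<close>

text \<open>If \<open>P\<close> is not contained in \<open>Q\<close>, the complement of \<open>vanishing \<Gamma> T u P\<close> is an open set
  that separates \<open>Q\<close> from \<open>P\<close>.\<close>

lemma (in gamma_semiring) specialization_iff_open:
  assumes "P \<in> Spec \<Gamma> T u" and "Q \<in> Spec \<Gamma> T u"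
  shows "P \<subseteq> Q \<longleftrightarrow> (\<forall>U. openin (spec_topology \<Gamma> T u) U \<longrightarrow> Q \<in> U \<longrightarrow> P \<in> U)"
proof
  assume "P \<subseteq> Q"
  then show "\<forall>U. openin (spec_topology \<Gamma> T u) U \<longrightarrow> Q \<in> U \<longrightarrow> P \<in> U"
    using assms by (auto simp: openin_spec_topology vanishing_def)
next
  assume *: "\<forall>U. openin (spec_topology \<Gamma> T u) U \<longrightarrow> Q \<in> U \<longrightarrow> P \<in> U"
  have "gamma_ideal \<Gamma> T u P" using assms(1) by (simp add: Spec_def prime_gamma_ideal_def)
  then have "openin (spec_topology \<Gamma> T u) (Spec \<Gamma> T u - vanishing \<Gamma> T u P)"
    unfolding openin_spec_topology by blast
  with * assms show "P \<subseteq> Q" by (auto simp: vanishing_def)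
qed

text \<open>Continuity pulls an open neighbourhood of \<open>h Q\<close> back to one of \<open>Q\<close>, which then
  contains every \<open>P \<subseteq> Q\<close>.\<close>

lemma continuous_map_spec_mono:
  assumes "gamma_semiring \<Gamma> S u" and "gamma_semiring \<Gamma> T v"
    and "continuous_map (spec_topology \<Gamma> S u) (spec_topology \<Gamma> T v) h"
    and "P \<in> Spec \<Gamma> S u" and "Q \<in> Spec \<Gamma> S u" and "P \<subseteq> Q"
  shows "h P \<subseteq> h Q"
proof -
  interpret S: gamma_semiring \<Gamma> S u by (rule assms(1))
  interpret T: gamma_semiring \<Gamma> T v by (rule assms(2))
  have h: "h x \<in> Spec \<Gamma> T v" if "x \<in> Spec \<Gamma> S u" for x
    using continuous_map_image_subset_topspace[OF assms(3)] that
    by (auto simp: S.topspace_spec_topology T.topspace_spec_topology)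
  show ?thesis
    unfolding T.specialization_iff_open[OF h[OF assms(4)] h[OF assms(5)]]
  proof (intro allI impI)
    fix W assume W: "openin (spec_topology \<Gamma> T v) W" "h Q \<in> W"
    have "openin (spec_topology \<Gamma> S u) {x \<in> Spec \<Gamma> S u. h x \<in> W}"
      using openin_continuous_map_preimage[OF assms(3) W(1)] by (simp add: S.topspace_spec_topology)
    then show "h P \<in> W"
      using S.specialization_iff_open[OF assms(4,5)] assms(5,6) W(2) by blast
  qed
qed

lemma edge_specialization_graph_iff:
  assumes "P \<in> Spec \<Gamma> T u" and "Q \<in> Spec \<Gamma> T u"
  shows "{P, Q} \<in> snd (specialization_graph \<Gamma> T u) \<longleftrightarrow> P \<noteq> Q \<and> (P \<subseteq> Q \<or> Q \<subseteq> P)"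
  using assms by (auto simp: specialization_graph_def doubleton_eq_iff)

lemma homeomorphic_maps_specialization_graph:
  assumes S: "gamma_semiring \<Gamma> S u" and T: "gamma_semiring \<Gamma> T v"
    and hk: "homeomorphic_maps (spec_topology \<Gamma> S u) (spec_topology \<Gamma> T v) h k"
  shows "graph_isomorphism (specialization_graph \<Gamma> S u) (specialization_graph \<Gamma> T v) h"
proof -
  note tops = gamma_semiring.topspace_spec_topology[OF S] gamma_semiring.topspace_spec_topology[OF T]
  have cont: "continuous_map (spec_topology \<Gamma> S u) (spec_topology \<Gamma> T v) h"
      "continuous_map (spec_topology \<Gamma> T v) (spec_topology \<Gamma> S u) k"
    and kh: "\<And>P. P \<in> Spec \<Gamma> S u \<Longrightarrow> k (h P) = P"
    and hk: "\<And>Q. Q \<in> Spec \<Gamma> T v \<Longrightarrow> h (k Q) = Q"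
    using hk by (auto simp: homeomorphic_maps_def tops)
  have h: "h P \<in> Spec \<Gamma> T v" if "P \<in> Spec \<Gamma> S u" for P
    using continuous_map_image_subset_topspace[OF cont(1)] that by (auto simp: tops)
  have k: "k Q \<in> Spec \<Gamma> S u" if "Q \<in> Spec \<Gamma> T v" for Q
    using continuous_map_image_subset_topspace[OF cont(2)] that by (auto simp: tops)
  have bij: "bij_betw h (Spec \<Gamma> S u) (Spec \<Gamma> T v)"
    by (rule bij_betwI[where g = k]) (use h k kh hk in auto)
  have sub: "h P \<subseteq> h Q \<longleftrightarrow> P \<subseteq> Q" if PQ: "P \<in> Spec \<Gamma> S u" "Q \<in> Spec \<Gamma> S u" for P Q
    using continuous_map_spec_mono[OF S T cont(1) PQ]
      continuous_map_spec_mono[OF T S cont(2) h[OF PQ(1)] h[OF PQ(2)]] kh PQ by auto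
  have eq: "h P = h Q \<longleftrightarrow> P = Q" if "P \<in> Spec \<Gamma> S u" "Q \<in> Spec \<Gamma> S u" for P Q
    using that kh by metis
  show ?thesis
    unfolding graph_isomorphism_def
  proof (intro conjI ballI)
    show "bij_betw h (fst (specialization_graph \<Gamma> S u)) (fst (specialization_graph \<Gamma> T v))"
      using bij by (simp add: specialization_graph_def)
    fix P Q assume "P \<in> fst (specialization_graph \<Gamma> S u)" "Q \<in> fst (specialization_graph \<Gamma> S u)"
    then have PQ: "P \<in> Spec \<Gamma> S u" "Q \<in> Spec \<Gamma> S u" by (simp_all add: specialization_graph_def)
    show "{P, Q} \<in> snd (specialization_graph \<Gamma> S u) \<longleftrightarrow>
        {h P, h Q} \<in> snd (specialization_graph \<Gamma> T v)"
      using PQ h by (simp add: edge_specialization_graph_iff sub eq)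
  qed
qed

lemma gamma_scheme_isomorphism_homeomorphic_maps:
  assumes "gamma_scheme_isomorphism \<Gamma> X Y \<phi>"
  shows "\<exists>k. homeomorphic_maps (topol X) (topol Y) (on_points \<phi>) k"
proof -
  obtain \<chi> where "gamma_scheme_morphism \<Gamma> X Y \<phi>" "gamma_scheme_morphism \<Gamma> Y X \<chi>"
    and "mutually_inverse X Y \<phi> \<chi>"
    using assms unfolding gamma_scheme_isomorphism_def by blast
  then have "homeomorphic_maps (topol X) (topol Y) (on_points \<phi>) (on_points \<chi>)"
    by (simp add: gamma_scheme_morphism_def semiringed_space_morphism_def mutually_inverse_def
        homeomorphic_maps_def)
  then show ?thesis by (rule exI[where x = "on_points \<chi>"])
qed

section \<open>Permutation matrices\<close>

lemma permutation_matrix_carrier [simp]: "permutation_matrix n p \<in> carrier_mat n n"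
  by (simp add: permutation_matrix_def)

lemma index_permutation_matrix [simp]:
  "i < n \<Longrightarrow> j < n \<Longrightarrow> permutation_matrix n p $$ (i, j) = (if i = p j then 1 else 0)"
  by (simp add: permutation_matrix_def)

lemma index_mult_permutation_matrix:
  assumes "p permutes {..<n}" and "A \<in> carrier_mat n n" and "i < n" and "j < n"
  shows "(A * permutation_matrix n p) $$ (i, j) = A $$ (i, p j)"
proof -
  have "p j < n" using permutes_in_image[OF assms(1), of j] assms(4) by simp
  have "(A * permutation_matrix n p) $$ (i, j) =
      (\<Sum>k\<in>{0..<n}. A $$ (i, k) * (if k = p j then 1 else 0))"
    using assms by (simp add: permutation_matrix_def scalar_prod_def)
  also have "\<dots> = (\<Sum>k\<in>{0..<n}. if k = p j then A $$ (i, k) else 0)"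
    by (rule sum.cong) auto
  also have "\<dots> = A $$ (i, p j)" using \<open>p j < n\<close> by simp
  finally show ?thesis .
qed

lemma index_inverse_permutation_matrix_mult:
  assumes "p permutes {..<n}" and "A \<in> carrier_mat n n" and "i < n" and "j < n"
  shows "(permutation_matrix n (inv_into UNIV p) * A) $$ (i, j) = A $$ (p i, j)"
proof -
  have "p i < n" using permutes_in_image[OF assms(1), of i] assms(3) by simp
  have inverse: "i = inv_into UNIV p k \<longleftrightarrow> k = p i" for k
    using permutes_inverses[OF assms(1)] by metis
  have "(permutation_matrix n (inv_into UNIV p) * A) $$ (i, j) =
      (\<Sum>k\<in>{0..<n}. (if k = p i then 1 else 0) * A $$ (k, j))"
    using assms by (simp add: permutation_matrix_def scalar_prod_def inverse)
  also have "\<dots> = (\<Sum>k\<in>{0..<n}. if k = p i then A $$ (k, j) else 0)"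
    by (rule sum.cong) auto
  also have "\<dots> = A $$ (p i, j)" using \<open>p i < n\<close> by simp
  finally show ?thesis .
qed

lemma permutation_matrix_inverses:
  assumes "p permutes {..<n}"
  shows "inverts_mat (permutation_matrix n p) (permutation_matrix n (inv_into UNIV p))"
    and "inverts_mat (permutation_matrix n (inv_into UNIV p)) (permutation_matrix n p)"
proof -
  have lt: "inv_into UNIV p j < n" "p j < n" if "j < n" for j
    using permutes_in_image[OF permutes_inv[OF assms], of j] permutes_in_image[OF assms, of j] that
    by simp_all
  note inverses = permutes_inverses[OF assms]
  show "inverts_mat (permutation_matrix n p) (permutation_matrix n (inv_into UNIV p))"
    unfolding inverts_mat_def
    by (rule eq_matI)
      (auto simp: index_mult_permutation_matrix[OF permutes_inv[OF assms]] lt inverses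
        carrier_matD[OF permutation_matrix_carrier] simp del: index_mult_mat(1))
  show "inverts_mat (permutation_matrix n (inv_into UNIV p)) (permutation_matrix n p)"
    unfolding inverts_mat_def
    by (rule eq_matI)
      (auto simp: index_mult_permutation_matrix[OF assms] lt inverses
        carrier_matD[OF permutation_matrix_carrier] simp del: index_mult_mat(1))
qed

section \<open>Laplacians of isomorphic graphs\<close>

lemma vertex_degree_isomorphism:
  assumes "graph_isomorphism G H \<phi>" and "v \<in> fst G"
  shows "vertex_degree H (\<phi> v) = vertex_degree G v"
proof -
  have bij: "bij_betw \<phi> (fst G) (fst H)"
    and edge: "\<And>w. w \<in> fst G \<Longrightarrow> {v, w} \<in> snd G \<longleftrightarrow> {\<phi> v, \<phi> w} \<in> snd H"
    using assms by (auto simp: graph_isomorphism_def)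
  have "bij_betw \<phi> {w \<in> fst G. {v, w} \<in> snd G} {w \<in> fst H. {\<phi> v, w} \<in> snd H}"
  proof (rule bij_betw_subset[OF bij])
    have "\<phi> ` {w \<in> fst G. {v, w} \<in> snd G} = {w \<in> \<phi> ` fst G. {\<phi> v, w} \<in> snd H}"
      using edge by auto
    then show "\<phi> ` {w \<in> fst G. {v, w} \<in> snd G} = {w \<in> fst H. {\<phi> v, w} \<in> snd H}"
      using bij by (simp add: bij_betw_def)
  qed auto
  from bij_betw_same_card[OF this] show ?thesis by (simp add: vertex_degree_def)
qed

text \<open>The lists \<open>map \<phi> xs\<close> and \<open>ys\<close> both enumerate the vertices of \<open>H\<close> without
  repetition, so they agree as multisets and one is a permutation of the other.\<close>

lemma graph_isomorphism_index_permutation: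
  assumes "graph_isomorphism G H \<phi>" and "vertex_ordering G xs" and "vertex_ordering H ys"
  obtains p where "length ys = length xs" and "p permutes {..<length xs}"
    and "\<And>j. j < length xs \<Longrightarrow> \<phi> (xs ! j) = ys ! p j"
proof -
  have "bij_betw \<phi> (set xs) (set ys)" and d: "distinct xs" "distinct ys"
    using assms by (auto simp: graph_isomorphism_def vertex_ordering_def)
  then have "distinct (map \<phi> xs)" "set (map \<phi> xs) = set ys"
    by (auto simp: distinct_map bij_betw_def)
  then have m: "mset (map \<phi> xs) = mset ys" using d(2) set_eq_iff_mset_eq_distinct by blast
  then have len: "length ys = length xs" by (metis length_map size_mset)
  obtain p where p: "p permutes {..<length ys}" "permute_list p ys = map \<phi> xs"
    using mset_eq_permutation[OF m] by blast
  have "\<phi> (xs ! j) = ys ! p j" if "j < length xs" for j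
    using permute_list_nth[OF p(1), of j] that p(2) len by simp
  with p(1) len that show ?thesis by metis
qed

lemma laplacian_carrier: "laplacian G xs \<in> carrier_mat (length xs) (length xs)"
  unfolding laplacian_def degree_matrix_def adjacency_matrix_def
  by (rule minus_carrier_mat) simp

lemma index_laplacian:
  "i < length xs \<Longrightarrow> j < length xs \<Longrightarrow> laplacian G xs $$ (i, j) =
    (if i = j then real (vertex_degree G (xs ! i)) else 0) -
    (if {xs ! i, xs ! j} \<in> snd G then 1 else 0)"
  by (simp add: laplacian_def degree_matrix_def adjacency_matrix_def)

text \<open>Multiplication by the matrix of the inverse permutation on the left selects row \<open>p i\<close>, and
  by the matrix of \<open>p\<close> on the right selects column \<open>p j\<close>.\<close>

lemma laplacian_conjugate:
  assumes iso: "graph_isomorphism G H \<phi>" and xs: "vertex_ordering G xs"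
    and len: "length ys = length xs" and p: "p permutes {..<length xs}"
    and \<phi>: "\<And>j. j < length xs \<Longrightarrow> \<phi> (xs ! j) = ys ! p j"
  shows "laplacian G xs =
    permutation_matrix (length xs) (inv_into UNIV p) * laplacian H ys * permutation_matrix (length xs) p"
    (is "_ = ?P' * ?L * ?P")
proof (rule eq_matI)
  have L: "?L \<in> carrier_mat (length xs) (length xs)" using laplacian_carrier[of H ys] len by simp
  have PL: "?P' * ?L \<in> carrier_mat (length xs) (length xs)"
    by (rule mult_carrier_mat[OF permutation_matrix_carrier L])
  then have PLP: "?P' * ?L * ?P \<in> carrier_mat (length xs) (length xs)"
    by (rule mult_carrier_mat) simp
  show "dim_row (laplacian G xs) = dim_row (?P' * ?L * ?P)"
    "dim_col (laplacian G xs) = dim_col (?P' * ?L * ?P)"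
    using PLP laplacian_carrier[of G xs] by auto
  fix i j assume "i < dim_row (?P' * ?L * ?P)" "j < dim_col (?P' * ?L * ?P)"
  then have i: "i < length xs" and j: "j < length xs" using PLP by auto
  have lt: "p k < length xs" if "k < length xs" for k
    using permutes_in_image[OF p, of k] that by simp
  have vert: "xs ! k \<in> fst G" if "k < length xs" for k
    using xs nth_mem[OF that] by (simp add: vertex_ordering_def)
  have eq: "p i = p j \<longleftrightarrow> i = j" using permutes_inj[OF p] by (auto simp: inj_def)
  have "(?P' * ?L * ?P) $$ (i, j) = ?L $$ (p i, p j)"
    by (simp only: index_mult_permutation_matrix[OF p PL i j]
        index_inverse_permutation_matrix_mult[OF p L i lt[OF j]])
  also have "\<dots> = laplacian G xs $$ (i, j)"
  proof -
    have "vertex_degree H (ys ! p i) = vertex_degree G (xs ! i)"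
      using vertex_degree_isomorphism[OF iso vert[OF i]] \<phi>[OF i] by simp
    moreover have "{ys ! p i, ys ! p j} \<in> snd H \<longleftrightarrow> {xs ! i, xs ! j} \<in> snd G"
      using iso vert[OF i] vert[OF j] \<phi>[OF i] \<phi>[OF j] by (simp add: graph_isomorphism_def)
    ultimately show ?thesis using i j lt[OF i] lt[OF j] len by (auto simp: index_laplacian eq)
  qed
  finally show "laplacian G xs $$ (i, j) = (?P' * ?L * ?P) $$ (i, j)" by simp
qed

section \<open>Invariance of the canonical Laplacian\<close>

theorem theorem7:
  fixes \<Gamma> :: "('g, 'k) monoid_scheme"
    and S :: "('a, 'm) ring_scheme" and u :: "'g \<Rightarrow> 'a"
    and T :: "('b, 'n) ring_scheme" and v :: "'g \<Rightarrow> 'b"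
    and \<psi> :: "('a set, 'a \<Rightarrow> ('a \<times> 'a) set, 'b set, 'b \<Rightarrow> ('b \<times> 'b) set) space_map"
  assumes "gamma_semiring \<Gamma> S u" and "gamma_semiring \<Gamma> T v"
    and "gamma_scheme_isomorphism \<Gamma> (affine_gamma_scheme \<Gamma> S u) (affine_gamma_scheme \<Gamma> T v) \<psi>"
    and "finite (Spec \<Gamma> S u)" and "finite (Spec \<Gamma> T v)"
  shows "graph_isomorphism (specialization_graph \<Gamma> S u) (specialization_graph \<Gamma> T v)
           (on_points \<psi>) \<and>
    (\<forall>xs ys. vertex_ordering (specialization_graph \<Gamma> S u) xs \<longrightarrow>
             vertex_ordering (specialization_graph \<Gamma> T v) ys \<longrightarrow>
       length ys = length xs \<and>
       (\<exists>p P P'. p permutes {..<length xs} \<and>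
          (\<forall>j < length xs. on_points \<psi> (xs ! j) = ys ! p j) \<and>
          P = permutation_matrix (length xs) p \<and>
          P' \<in> carrier_mat (length xs) (length xs) \<and>
          inverts_mat P P' \<and> inverts_mat P' P \<and>
          laplacian (specialization_graph \<Gamma> S u) xs =
            P' * laplacian (specialization_graph \<Gamma> T v) ys * P))"
proof (intro conjI allI impI)
  let ?G = "specialization_graph \<Gamma> S u" and ?H = "specialization_graph \<Gamma> T v"
  obtain k where
    "homeomorphic_maps (spec_topology \<Gamma> S u) (spec_topology \<Gamma> T v) (on_points \<psi>) k"
    using gamma_scheme_isomorphism_homeomorphic_maps[OF assms(3)]
    by (auto simp: affine_gamma_scheme_def)
  then show iso: "graph_isomorphism ?G ?H (on_points \<psi>)"
    by (rule homeomorphic_maps_specialization_graph[OF assms(1,2)])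
  fix xs ys assume xs: "vertex_ordering ?G xs" and ys: "vertex_ordering ?H ys"
  obtain p where len: "length ys = length xs" and p: "p permutes {..<length xs}"
    and \<psi>: "\<And>j. j < length xs \<Longrightarrow> on_points \<psi> (xs ! j) = ys ! p j"
    by (rule graph_isomorphism_index_permutation[OF iso xs ys]) blast
  show "length ys = length xs" by (rule len)
  show "\<exists>p P P'. p permutes {..<length xs} \<and>
      (\<forall>j < length xs. on_points \<psi> (xs ! j) = ys ! p j) \<and>
      P = permutation_matrix (length xs) p \<and>
      P' \<in> carrier_mat (length xs) (length xs) \<and>
      inverts_mat P P' \<and> inverts_mat P' P \<and>
      laplacian ?G xs = P' * laplacian ?H ys * P"
    using p \<psi> permutation_matrix_inverses[OF p] laplacian_conjugate[OF iso xs len p \<psi>]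
      permutation_matrix_carrier by blast
qed

end
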